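(* Let the data $A,b,\sigma,\psi,\phi,\mathcal G_1,\dots,\mathcal G_q$ satisfy the standing assumptions in the context, let $\{x^k\}_{k\in\mathbb N}$, $\{\tilde x^k\}_{k\in\mathbb N}$ be (infinite) sequences generated by the algorithm described in the context, and let $\{\tilde\lambda_k\}_{k\in\mathbb N}$ be the associated multipliers defined in the context. Then: (i) $\liminf_{k\to\infty}\tilde\lambda_k>0$. (ii) $\lim_{k\to\infty}\phi'_+\big((a_i^Tx^k-b_i)^2\big)\,\big(a_i^T(\tilde x^{k+1}-x^k)\big)=0$ for all $i=1,\dots,m$. (iii) $\Phi\big((Ax^*-b)\circ(Ax^*-b)\big)=\sigma$ for every accumulation point $x^*$ of $\{x^k\}_{k\in\mathbb N}$. (iv) The sequence $\{\tilde\lambda_k\}_{k\in\mathbb N}$ is bounded. (v) Every accumulation point of $\{x^k\}_{k\in\mathbb N}$ is a stationary point (as defined in the context) of the problem $$\min_{x\in\mathbb R^n}\sum_{i=1}^q\psi(\|x_{\mathcal G_i}\|)\quad\text{s.t.}\quad\sum_{i=1}^m\phi\big((a_i^Tx-b_i)^2\big)\le\sigma.$$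
   Context: **Problem data.** $m\ll n$; $A\in\mathbb R^{m\times n}$ has rows $a_1^T,\dots,a_m^T$; $b\in\mathbb R^m$; $\sigma>0$; $\{\mathcal G_1,\dots,\mathcal G_q\}$ is a partition of $\{1,\dots,n\}$ into disjoint groups; $x_{\mathcal G_i}$ is the subvector of $x\in\mathbb R^n$ indexed by $\mathcal G_i$; $\psi,\phi:\mathbb R_+\to\mathbb R_+$. $\|\cdot\|$ is the Euclidean norm and $\circ$ is the entrywise product. **Standing assumptions.** (a) $\psi$ is continuous and strictly concave on $\mathbb R_+$, $\psi(0)=0$, $\lim_{t\to\infty}\psi(t)=\infty$, $\psi$ is differentiable on $(0,\infty)$ with $\psi'(t)>0$ there, and $\lim_{t\downarrow0}\psi'(t)$ exists in $(0,\infty)$. (b) $\phi$ is continuous and concave on $\mathbb R_+$, $\phi(0)=0$, differentiable on $(0,\infty)$ with $\phi'(t)\ge0$ there, and $\lim_{t\downarrow0}\phi'(t)$ exists in $(0,\infty)$. (c) $A$ has full row rank and $\sigma\in\big(0,\sum_{i=1}^m\phi(b_i^2)\big)$. (d) There is $x\in\mathbb R^n$ with $\sum_{i=1}^m\phi((a_i^Tx-b_i)^2)=\sigma$, and $\sigma\notin\{j\bar\phi: j=1,\dots,m\}$, where $\bar\phi=\sup_{t\ge0}\phi(t)\in(0,\infty]$. **Notation.** $\psi'_+,\phi'_+$ are right derivatives on $\mathbb R_+$. For $y\in\mathbb R^m_+$, $\Phi(y)=\sum_i\phi(y_i)$ and $\Phi'_+(y)=(\phi'_+(y_i))_i$; for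 $z\in\mathbb R^q_+$, $\Psi'_+(z)=(\psi'_+(z_i))_i$. $G(x)=x_{\mathcal G}=(\|x_{\mathcal G_1}\|,\dots,\|x_{\mathcal G_q}\|)^T$. For $\omega\in\mathbb R^q_{+}$ with positive entries, $\|\omega\circ G(x)\|_1=\sum_i\omega_i\|x_{\mathcal G_i}\|$, and $\partial(\omega\circ G)(x)=\omega\circ\partial G(x)$ denotes the subdifferential of this function, i.e. the set of $\xi\in\mathbb R^n$ with $\xi_{\mathcal G_i}=\omega_ix_{\mathcal G_i}/\|x_{\mathcal G_i}\|$ if $x_{\mathcal G_i}\ne0$ and $\|\xi_{\mathcal G_i}\|\le\omega_i$ if $x_{\mathcal G_i}=0$. $N_U(u)$ is the normal cone to the convex set $U$ at $u$ (empty if $u\notin U$). $A^\dagger$ is the pseudoinverse of $A$. **Stationary point.** $x\in\mathbb R^n$ is a stationary point of the problem if there is $\lambda\ge0$ such that $\lambda\big(\Phi((Ax-b)\circ(Ax-b))-\sigma\big)=0$, $\Phi((Ax-b)\circ(Ax-b))\le\sigma$, and $$0\in\Psi'_+(x_{\mathcal G})\circ\partial G(x)+2\lambda\sum_{i=1}^m\phi'_+\big((a_i^Tx-b_i)^2\big)(a_i^Tx-b_i)a_i.$$ **Bregman distance.** $f:\mathbb R^n\to\mathbb R\cup\{+\infty\}$ is a fixed continuously differentiable (in particular finite-valued) and strictly convex function; $D^f(x,x_0)=f(x)-f(x_0)-\langle\nabla f(x_0),x-x_0\rangle$; for a set $C\subseteq\mathbb R^n$, $D^f(C,x_0)=\inf_{y\in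 C}D^f(y,x_0)$, with value $\infty$ if $C=\emptyset$. **Algorithm.** Let $\{\tau_k\}$ be a positive sequence converging to $0$ and $\{\mu_k\}$ a positive summable sequence; $x^0=A^\dagger b$. For $k=0,1,2,\dots$ (run without outer termination), set $\omega^k_{\mathcal G}=\Psi'_+(x^k_{\mathcal G})$, $y^k=Ax^k-b$, $\upsilon^k=\sqrt{\Phi'_+(y^k\circ y^k)}$ (entrywise), $A_k=\mathrm{Diag}(\upsilon^k)A$, $b^k=\upsilon^k\circ b$, $\sigma_k=\sigma+\|A_kx^k-b^k\|^2-\Phi(y^k\circ y^k)$ (one has $0<\sigma_k\le\sigma$), $U^k=\{u\in\mathbb R^m:\|u\|^2\le\sigma_k\}$. Choose $\epsilon_k\in(0,\min\{\sigma_k,\sqrt{\sigma_k},\tau_k\}]$ and a pair $(\tilde x^{k+1},\tilde u^{k+1})\in\mathbb R^n\times\mathbb R^m$ satisfying - $D^f\big(\partial(\omega^k_{\mathcal G}\circ G)(\tilde x^{k+1})+A_k^TN_{U^k}(\tilde u^{k+1}),\,0\big)\le\epsilon_k$, - $\|A_k\tilde x^{k+1}-b^k-\tilde u^{k+1}\|\le\epsilon_k$, - $\|\omega^k_{\mathcal G}\circ G(P_k(\tilde x^{k+1}))\|_1\le\|\omega^k_{\mathcal G}\circ x^k_{\mathcal G}\|_1+\mu_k$, where $P_k(x)=x$ if $\|A_kx-b^k\|^2\le\sigma_k$, and otherwise $P_k(x)=\Big(1-\frac{\sqrt{\sigma_k}}{\|A_kx-b^k\|}\Big)A^\dagger b+\frac{\sqrt{\sigma_k}}{\|A_kx-b^k\|}x$.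 Set $x^{k+1}=P_k(\tilde x^{k+1})$. **Multipliers $\tilde\lambda_k$.** By the first criterion, for each $k$ there is $\xi^k\in\partial(\omega^k_{\mathcal G}\circ G)(\tilde x^{k+1})+A_k^TN_{U^k}(\tilde u^{k+1})$ with $D^f(\xi^k,0)\le\epsilon_k$; since $\sigma_k>0$, by the form of the normal cone there is $\tilde\lambda_k\ge0$ with $$\xi^k\in\omega^k_{\mathcal G}\circ\partial G(\tilde x^{k+1})+\tilde\lambda_kA_k^T\tilde u^{k+1},\qquad\tilde\lambda_k\big(\|\tilde u^{k+1}\|^2-\sigma_k\big)=0.$$ Such $\xi^k,\tilde\lambda_k$ are fixed for each $k$. *)

theory Defs
  imports "HOL-Analysis.Analysis"
begin

section \<open>Convex analysis\<close>

definition strictly_convex_on :: "'a::real_vector set \<Rightarrow> ('a \<Rightarrow> real) \<Rightarrow> bool" where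
  "strictly_convex_on S f \<longleftrightarrow> convex S \<and>
     (\<forall>x\<in>S. \<forall>y\<in>S. \<forall>u>0. \<forall>v>0. x \<noteq> y \<longrightarrow> u + v = 1 \<longrightarrow>
        f (u *\<^sub>R x + v *\<^sub>R y) < u * f x + v * f y)"

definition strictly_concave_on :: "'a::real_vector set \<Rightarrow> ('a \<Rightarrow> real) \<Rightarrow> bool" where
  "strictly_concave_on S f \<longleftrightarrow> strictly_convex_on S (\<lambda>x. - f x)"

definition subdifferential :: "('a::real_inner \<Rightarrow> real) \<Rightarrow> 'a \<Rightarrow> 'a set" where
  "subdifferential f x = {\<xi>. \<forall>y. f y \<ge> f x + \<xi> \<bullet> (y - x)}"

definition normal_cone :: "'a::real_inner set \<Rightarrow> 'a \<Rightarrow> 'a set" where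
  "normal_cone U u = (if u \<in> U then {v. \<forall>w\<in>U. v \<bullet> (w - u) \<le> 0} else {})"

definition gradient :: "('a::real_inner \<Rightarrow> real) \<Rightarrow> 'a \<Rightarrow> 'a" where
  "gradient f x = (THE g. GDERIV f x :> g)"

definition continuously_differentiable :: "('a::real_inner \<Rightarrow> real) \<Rightarrow> bool" where
  "continuously_differentiable f \<longleftrightarrow>
     (\<exists>g. (\<forall>x. GDERIV f x :> g x) \<and> continuous_on UNIV g)"

definition bregman :: "('a::real_inner \<Rightarrow> real) \<Rightarrow> 'a \<Rightarrow> 'a \<Rightarrow> real" where
  "bregman f x x0 = f x - f x0 - gradient f x0 \<bullet> (x - x0)"

text \<open>The infimum is taken in the extended reals, so it is \<open>\<infinity>\<close> for \<open>C = {}\<close>.\<close>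

definition bregman_set :: "('a::real_inner \<Rightarrow> real) \<Rightarrow> 'a set \<Rightarrow> 'a \<Rightarrow> ereal" where
  "bregman_set f C x0 = (INF y\<in>C. ereal (bregman f y x0))"

definition accumulation_point :: "(nat \<Rightarrow> 'a::topological_space) \<Rightarrow> 'a \<Rightarrow> bool" where
  "accumulation_point X l \<longleftrightarrow> (\<exists>r::nat \<Rightarrow> nat. strict_mono r \<and> (X \<circ> r) \<longlonglongrightarrow> l)"

definition right_deriv :: "(real \<Rightarrow> real) \<Rightarrow> real \<Rightarrow> real" where
  "right_deriv f t = (THE D. (f has_real_derivative D) (at_right t))"


section \<open>Vectors and matrices\<close>

text \<open>Entrywise products of vectors are written \<open>x * y\<close>, the library's multiplication on
  \<^typ>\<open>real ^ 'n\<close>.\<close>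

definition norm1 :: "real ^ 'n \<Rightarrow> real" where
  "norm1 x = (\<Sum>i\<in>UNIV. \<bar>x $ i\<bar>)"

definition sum_entries :: "(real \<Rightarrow> real) \<Rightarrow> real ^ 'n \<Rightarrow> real" where
  "sum_entries h y = (\<Sum>i\<in>UNIV. h (y $ i))"

definition right_deriv_entries :: "(real \<Rightarrow> real) \<Rightarrow> real ^ 'n \<Rightarrow> real ^ 'n" where
  "right_deriv_entries h y = (\<chi> i. right_deriv h (y $ i))"

definition diag_matrix :: "real ^ 'n \<Rightarrow> real ^ 'n ^ 'n" where
  "diag_matrix v = (\<chi> i j. if i = j then v $ i else 0)"

text \<open>The Moore--Penrose inverse, given by the four Penrose equations, which have exactly one
  solution.\<close>

definition penrose_inverse :: "real ^ 'n ^ 'm \<Rightarrow> real ^ 'm ^ 'n \<Rightarrow> bool" where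
  "penrose_inverse A X \<longleftrightarrow> A ** X ** A = A \<and> X ** A ** X = X \<and>
     transpose (A ** X) = A ** X \<and> transpose (X ** A) = X ** A"

definition pseudoinverse :: "real ^ 'n ^ 'm \<Rightarrow> real ^ 'm ^ 'n" where
  "pseudoinverse A = (THE X. penrose_inverse A X)"


section \<open>Groups of coordinates\<close>

text \<open>The groups are given as a family \<open>G\<close> indexed by a finite type; distinct indices have
  distinct (hence disjoint) nonempty groups.\<close>

definition group_partition :: "('q::finite \<Rightarrow> 'n set) \<Rightarrow> bool" where
  "group_partition G \<longleftrightarrow> inj G \<and> partition_on UNIV (range G)"

text \<open>A subvector is represented in the full space, padded by zeros outside the group; this does
  not change its norm, its linear combinations or whether it vanishes.\<close>

definition subvec :: "'n set \<Rightarrow> real ^ 'n \<Rightarrow> real ^ 'n" where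
  "subvec S x = (\<chi> j. if j \<in> S then x $ j else 0)"

definition group_norms :: "('q \<Rightarrow> 'n::finite set) \<Rightarrow> real ^ 'n \<Rightarrow> real ^ 'q" where
  "group_norms G x = (\<chi> i. norm (subvec (G i) x))"

definition weighted_norm :: "('q::finite \<Rightarrow> 'n::finite set) \<Rightarrow> real ^ 'q \<Rightarrow> real ^ 'n \<Rightarrow> real" where
  "weighted_norm G \<omega> x = norm1 (\<omega> * group_norms G x)"


section \<open>The problem\<close>

text \<open>Functions on the nonnegative half-line are represented by functions on \<^typ>\<open>real\<close>; nothing
  is assumed about their values at negative arguments.\<close>

definition psi_assumption :: "(real \<Rightarrow> real) \<Rightarrow> bool" where
  "psi_assumption \<psi> \<longleftrightarrow>
     (\<forall>t\<ge>0. \<psi> t \<ge> 0) \<and> continuous_on {0..} \<psi> \<and> strictly_concave_on {0..} \<psi> \<and>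
     \<psi> 0 = 0 \<and> filterlim \<psi> at_top at_top \<and>
     (\<forall>t>0. \<psi> differentiable (at t) \<and> deriv \<psi> t > 0) \<and>
     (\<exists>L>0. (deriv \<psi> \<longlongrightarrow> L) (at_right 0))"

definition phi_assumption :: "(real \<Rightarrow> real) \<Rightarrow> bool" where
  "phi_assumption \<phi> \<longleftrightarrow>
     (\<forall>t\<ge>0. \<phi> t \<ge> 0) \<and> continuous_on {0..} \<phi> \<and> concave_on {0..} \<phi> \<and>
     \<phi> 0 = 0 \<and>
     (\<forall>t>0. \<phi> differentiable (at t) \<and> deriv \<phi> t \<ge> 0) \<and>
     (\<exists>L>0. (deriv \<phi> \<longlongrightarrow> L) (at_right 0))"

definition phi_bar :: "(real \<Rightarrow> real) \<Rightarrow> ereal" where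
  "phi_bar \<phi> = (SUP t\<in>{0..}. ereal (\<phi> t))"

definition standing_assumptions ::
  "real ^ 'n ^ 'm \<Rightarrow> real ^ 'm \<Rightarrow> real \<Rightarrow> (real \<Rightarrow> real) \<Rightarrow> (real \<Rightarrow> real) \<Rightarrow> bool" where
  "standing_assumptions A b \<sigma> \<psi> \<phi> \<longleftrightarrow>
     psi_assumption \<psi> \<and> phi_assumption \<phi> \<and>
     rank A = CARD('m) \<and> 0 < \<sigma> \<and> \<sigma> < (\<Sum>i\<in>UNIV. \<phi> ((b $ i)\<^sup>2)) \<and>
     (\<exists>x. (\<Sum>i\<in>UNIV. \<phi> ((row i A \<bullet> x - b $ i)\<^sup>2)) = \<sigma>) \<and>
     (\<forall>j\<in>{1..CARD('m)}. ereal \<sigma> \<noteq> ereal (real j) * phi_bar \<phi>)"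

definition stationary_point ::
  "real ^ 'n ^ 'm \<Rightarrow> real ^ 'm \<Rightarrow> real \<Rightarrow> (real \<Rightarrow> real) \<Rightarrow> (real \<Rightarrow> real) \<Rightarrow>
   ('q::finite \<Rightarrow> 'n set) \<Rightarrow> real ^ 'n \<Rightarrow> bool" where
  "stationary_point A b \<sigma> \<psi> \<phi> G x \<longleftrightarrow>
     (\<exists>l\<ge>0.
        l * (sum_entries \<phi> ((A *v x - b) * (A *v x - b)) - \<sigma>) = 0 \<and>
        sum_entries \<phi> ((A *v x - b) * (A *v x - b)) \<le> \<sigma> \<and>
        0 \<in> {\<xi> + (2 * l) *\<^sub>R
               (\<Sum>i\<in>UNIV. (right_deriv \<phi> ((row i A \<bullet> x - b $ i)\<^sup>2) * (row i A \<bullet> x - b $ i)) *\<^sub>R row i A)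
             | \<xi>. \<xi> \<in> subdifferential
                       (weighted_norm G (right_deriv_entries \<psi> (group_norms G x))) x})"


section \<open>The algorithm\<close>

text \<open>The quantities \<open>\<omega>\<^sup>k\<close>, \<open>\<upsilon>\<^sup>k\<close>, \<open>A\<^sub>k\<close>, \<open>b\<^sup>k\<close>, \<open>\<sigma>\<^sub>k\<close> of an iteration, as functions of the current
  iterate \<open>x\<close>.\<close>

definition iter_weight :: "(real \<Rightarrow> real) \<Rightarrow> ('q \<Rightarrow> 'n::finite set) \<Rightarrow> real ^ 'n \<Rightarrow> real ^ 'q" where
  "iter_weight \<psi> G x = right_deriv_entries \<psi> (group_norms G x)"

definition iter_scale ::
  "real ^ 'n ^ 'm \<Rightarrow> real ^ 'm \<Rightarrow> (real \<Rightarrow> real) \<Rightarrow> real ^ 'n \<Rightarrow> real ^ 'm" where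
  "iter_scale A b \<phi> x =
     (\<chi> i. sqrt (right_deriv_entries \<phi> ((A *v x - b) * (A *v x - b)) $ i))"

definition iter_matrix ::
  "real ^ 'n ^ 'm \<Rightarrow> real ^ 'm \<Rightarrow> (real \<Rightarrow> real) \<Rightarrow> real ^ 'n \<Rightarrow> real ^ 'n ^ 'm" where
  "iter_matrix A b \<phi> x = diag_matrix (iter_scale A b \<phi> x) ** A"

definition iter_rhs ::
  "real ^ 'n ^ 'm \<Rightarrow> real ^ 'm \<Rightarrow> (real \<Rightarrow> real) \<Rightarrow> real ^ 'n \<Rightarrow> real ^ 'm" where
  "iter_rhs A b \<phi> x = iter_scale A b \<phi> x * b"

definition iter_sigma ::
  "real ^ 'n ^ 'm \<Rightarrow> real ^ 'm \<Rightarrow> real \<Rightarrow> (real \<Rightarrow> real) \<Rightarrow> real ^ 'n \<Rightarrow> real" where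
  "iter_sigma A b \<sigma> \<phi> x =
     \<sigma> + (norm (iter_matrix A b \<phi> x *v x - iter_rhs A b \<phi> x))\<^sup>2
       - sum_entries \<phi> ((A *v x - b) * (A *v x - b))"

definition optimality_set ::
  "real ^ 'n ^ 'm \<Rightarrow> real ^ 'm \<Rightarrow> real \<Rightarrow> (real \<Rightarrow> real) \<Rightarrow> (real \<Rightarrow> real) \<Rightarrow>
   ('q::finite \<Rightarrow> 'n set) \<Rightarrow> real ^ 'n \<Rightarrow> real ^ 'n \<Rightarrow> real ^ 'm \<Rightarrow> (real ^ 'n) set" where
  "optimality_set A b \<sigma> \<psi> \<phi> G x xt ut =
     {g + transpose (iter_matrix A b \<phi> x) *v v | g v.
        g \<in> subdifferential (weighted_norm G (iter_weight \<psi> G x)) xt \<and>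
        v \<in> normal_cone {u. (norm u)\<^sup>2 \<le> iter_sigma A b \<sigma> \<phi> x} ut}"

definition iter_retract ::
  "real ^ 'n ^ 'm \<Rightarrow> real ^ 'm \<Rightarrow> real \<Rightarrow> (real \<Rightarrow> real) \<Rightarrow> real ^ 'n \<Rightarrow> real ^ 'n \<Rightarrow> real ^ 'n" where
  "iter_retract A b \<sigma> \<phi> x z =
     (let r = norm (iter_matrix A b \<phi> x *v z - iter_rhs A b \<phi> x);
          s = iter_sigma A b \<sigma> \<phi> x
      in if r\<^sup>2 \<le> s then z
         else (1 - sqrt s / r) *\<^sub>R (pseudoinverse A *v b) + (sqrt s / r) *\<^sub>R z)"

definition algorithm_step ::
  "real ^ 'n ^ 'm \<Rightarrow> real ^ 'm \<Rightarrow> real \<Rightarrow> (real \<Rightarrow> real) \<Rightarrow> (real \<Rightarrow> real) \<Rightarrow>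
   ('q::finite \<Rightarrow> 'n set) \<Rightarrow> (real ^ 'n \<Rightarrow> real) \<Rightarrow> real \<Rightarrow> real \<Rightarrow> real \<Rightarrow>
   real ^ 'n \<Rightarrow> real ^ 'n \<Rightarrow> real ^ 'm \<Rightarrow> real ^ 'n \<Rightarrow> bool" where
  "algorithm_step A b \<sigma> \<psi> \<phi> G f \<tau> \<mu> \<epsilon> x xt ut x' \<longleftrightarrow>
     0 < \<epsilon> \<and>
     \<epsilon> \<le> Min {iter_sigma A b \<sigma> \<phi> x, sqrt (iter_sigma A b \<sigma> \<phi> x), \<tau>} \<and>
     bregman_set f (optimality_set A b \<sigma> \<psi> \<phi> G x xt ut) 0 \<le> ereal \<epsilon> \<and>
     norm (iter_matrix A b \<phi> x *v xt - iter_rhs A b \<phi> x - ut) \<le> \<epsilon> \<and>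
     weighted_norm G (iter_weight \<psi> G x) (iter_retract A b \<sigma> \<phi> x xt)
       \<le> weighted_norm G (iter_weight \<psi> G x) x + \<mu> \<and>
     x' = iter_retract A b \<sigma> \<phi> x xt"

text \<open>The values \<open>xt 0\<close> and \<open>ut 0\<close> play no role.\<close>

definition generated_by_algorithm ::
  "real ^ 'n ^ 'm \<Rightarrow> real ^ 'm \<Rightarrow> real \<Rightarrow> (real \<Rightarrow> real) \<Rightarrow> (real \<Rightarrow> real) \<Rightarrow>
   ('q::finite \<Rightarrow> 'n set) \<Rightarrow> (real ^ 'n \<Rightarrow> real) \<Rightarrow>
   (nat \<Rightarrow> real) \<Rightarrow> (nat \<Rightarrow> real) \<Rightarrow> (nat \<Rightarrow> real) \<Rightarrow>
   (nat \<Rightarrow> real ^ 'n) \<Rightarrow> (nat \<Rightarrow> real ^ 'n) \<Rightarrow> (nat \<Rightarrow> real ^ 'm) \<Rightarrow> bool" where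
  "generated_by_algorithm A b \<sigma> \<psi> \<phi> G f \<tau> \<mu> \<epsilon> x xt ut \<longleftrightarrow>
     (\<forall>k. \<tau> k > 0) \<and> \<tau> \<longlonglongrightarrow> 0 \<and> (\<forall>k. \<mu> k > 0) \<and> summable \<mu> \<and>
     x 0 = pseudoinverse A *v b \<and>
     (\<forall>k. algorithm_step A b \<sigma> \<psi> \<phi> G f (\<tau> k) (\<mu> k) (\<epsilon> k)
            (x k) (xt (Suc k)) (ut (Suc k)) (x (Suc k)))"

definition associated_multiplier ::
  "real ^ 'n ^ 'm \<Rightarrow> real ^ 'm \<Rightarrow> real \<Rightarrow> (real \<Rightarrow> real) \<Rightarrow> (real \<Rightarrow> real) \<Rightarrow>
   ('q::finite \<Rightarrow> 'n set) \<Rightarrow> (real ^ 'n \<Rightarrow> real) \<Rightarrow> real \<Rightarrow>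
   real ^ 'n \<Rightarrow> real ^ 'n \<Rightarrow> real ^ 'm \<Rightarrow> real ^ 'n \<Rightarrow> real \<Rightarrow> bool" where
  "associated_multiplier A b \<sigma> \<psi> \<phi> G f \<epsilon> x xt ut \<xi> l \<longleftrightarrow>
     \<xi> \<in> optimality_set A b \<sigma> \<psi> \<phi> G x xt ut \<and>
     bregman f \<xi> 0 \<le> \<epsilon> \<and>
     0 \<le> l \<and>
     \<xi> \<in> {g + l *\<^sub>R (transpose (iter_matrix A b \<phi> x) *v ut)
         | g. g \<in> subdifferential (weighted_norm G (iter_weight \<psi> G x)) xt} \<and>
     l * ((norm ut)\<^sup>2 - iter_sigma A b \<sigma> \<phi> x) = 0"


section \<open>Consistency of the definitions\<close>

lemma penrose_inverse_unique:
  fixes A :: "real ^ 'n ^ 'm"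
  assumes X: "penrose_inverse A X" and Y: "penrose_inverse A Y"
  shows "X = Y"
proof -
  have ax: "A ** X ** A = A" "X ** A ** X = X" "transpose (A ** X) = A ** X"
    "transpose (X ** A) = X ** A" using X by (auto simp: penrose_inverse_def)
  have ay: "A ** Y ** A = A" "Y ** A ** Y = Y" "transpose (A ** Y) = A ** Y"
    "transpose (Y ** A) = Y ** A" using Y by (auto simp: penrose_inverse_def)
  have "X = X ** (A ** X)" using ax(2) by (simp only: matrix_mul_assoc)
  also have "A ** X = (A ** Y) ** (A ** X)"
    using ay(1) by (simp only: matrix_mul_assoc)
  also have "\<dots> = transpose ((A ** X) ** (A ** Y))"
    using matrix_transpose_mul[of "A ** X" "A ** Y"] by (simp only: ax(3) ay(3))
  also have "(A ** X) ** (A ** Y) = A ** Y"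
    using ax(1) by (simp only: matrix_mul_assoc)
  also have "X ** transpose (A ** Y) = (X ** A) ** Y"
    by (simp only: ay(3) matrix_mul_assoc)
  also have "X ** A = (X ** A) ** (Y ** A)"
  proof -
    have "(X ** A) ** (Y ** A) = X ** (A ** Y ** A)" by (simp only: matrix_mul_assoc)
    then show ?thesis by (simp only: ay(1))
  qed
  also have "\<dots> = transpose ((Y ** A) ** (X ** A))"
    using matrix_transpose_mul[of "Y ** A" "X ** A"] by (simp only: ax(4) ay(4))
  also have "(Y ** A) ** (X ** A) = Y ** A"
  proof -
    have "(Y ** A) ** (X ** A) = Y ** (A ** X ** A)" by (simp only: matrix_mul_assoc)
    then show ?thesis by (simp only: ax(1))
  qed
  also have "transpose (Y ** A) ** Y = Y" by (simp only: ay(2,4))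
  finally show ?thesis .
qed

lemma pseudoinverse_eqI:
  assumes "penrose_inverse A X"
  shows "pseudoinverse A = X"
  unfolding pseudoinverse_def using assms penrose_inverse_unique by blast

lemma subvec_add: "subvec S (x + y) = subvec S x + subvec S y"
  by (simp add: subvec_def vec_eq_iff)

lemma subvec_minus: "subvec S (x - y) = subvec S x - subvec S y"
  by (simp add: subvec_def vec_eq_iff)

lemma inner_subvec_right: "x \<bullet> subvec S y = subvec S x \<bullet> subvec S (y :: real ^ 'n)"
  by (auto simp: inner_vec_def subvec_def intro!: sum.cong)

lemma group_partition_disjoint:
  assumes "group_partition G" "i \<noteq> j"
  shows "G i \<inter> G j = {}"
proof -
  have "G i \<noteq> G j" using assms by (auto simp: group_partition_def inj_eq)
  then show ?thesis
    using assms(1) by (auto simp: group_partition_def partition_on_def disjoint_def)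
qed

lemma subvec_subvec:
  assumes "group_partition G"
  shows "subvec (G j) (subvec (G i) x) = (if i = j then subvec (G i) x else 0)"
  using group_partition_disjoint[OF assms, of i j] by (auto simp: subvec_def vec_eq_iff)

lemma sum_subvec:
  fixes x :: "real ^ 'n"
  assumes "group_partition G"
  shows "(\<Sum>i\<in>UNIV. subvec (G i) x) = x"
proof -
  have "(\<Sum>i\<in>UNIV. if k \<in> G i then x $ k else 0) = x $ k" for k
  proof -
    have "k \<in> \<Union> (range G)"
      using assms by (simp add: group_partition_def partition_on_def)
    then obtain i where i: "k \<in> G i" by blast
    then have "k \<in> G j \<longleftrightarrow> j = i" for j
      using group_partition_disjoint[OF assms, of i j] by auto
    then show ?thesis by simp
  qed
  then show ?thesis by (simp add: vec_eq_iff subvec_def)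
qed

text \<open>For nonnegative weights, the subdifferential of the weighted group norm is the groupwise set
  described by normalised subvectors.\<close>

lemma subdifferential_weighted_norm:
  fixes \<omega> :: "real ^ 'q" and x :: "real ^ 'n"
  assumes G: "group_partition G" and \<omega>: "\<And>i. 0 \<le> \<omega> $ i"
  shows "subdifferential (weighted_norm G \<omega>) x =
    {\<xi>. \<forall>i. (subvec (G i) x \<noteq> 0 \<longrightarrow>
               subvec (G i) \<xi> = (\<omega> $ i / norm (subvec (G i) x)) *\<^sub>R subvec (G i) x) \<and>
            (subvec (G i) x = 0 \<longrightarrow> norm (subvec (G i) \<xi>) \<le> \<omega> $ i)}" (is "?L = ?R")
proof -
  have F: "weighted_norm G \<omega> z = (\<Sum>i\<in>UNIV. \<omega> $ i * norm (subvec (G i) z))" for z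
    using \<omega> by (simp add: weighted_norm_def norm1_def group_norms_def abs_mult)
  have R_if: "\<xi> \<in> ?R" if \<xi>: "\<xi> \<in> ?L" for \<xi>
  proof -
    have key: "\<omega> $ i * norm (subvec (G i) x) + subvec (G i) \<xi> \<bullet> subvec (G i) d
                 \<le> \<omega> $ i * norm (subvec (G i) x + subvec (G i) d)" for i d
    proof -
      let ?y = "x + subvec (G i) d"
      have "weighted_norm G \<omega> x + \<xi> \<bullet> (?y - x) \<le> weighted_norm G \<omega> ?y"
        using \<xi> by (simp only: subdifferential_def mem_Collect_eq)
      moreover have "weighted_norm G \<omega> ?y = \<omega> $ i * norm (subvec (G i) x + subvec (G i) d)
          + (\<Sum>j\<in>UNIV - {i}. \<omega> $ j * norm (subvec (G j) x))"
        unfolding F by (subst sum.remove[of _ i])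
          (auto simp: subvec_add subvec_subvec[OF G] intro!: sum.cong)
      moreover have "weighted_norm G \<omega> x = \<omega> $ i * norm (subvec (G i) x)
          + (\<Sum>j\<in>UNIV - {i}. \<omega> $ j * norm (subvec (G j) x))"
        unfolding F by (subst sum.remove[of _ i]) auto
      moreover have "\<xi> \<bullet> (?y - x) = subvec (G i) \<xi> \<bullet> subvec (G i) d"
        using inner_subvec_right[of \<xi> "G i" d] by simp
      ultimately show ?thesis by linarith
    qed
    have bound: "norm (subvec (G i) \<xi>) \<le> \<omega> $ i" for i
    proof (cases "subvec (G i) \<xi> = 0")
      case False
      have "\<omega> $ i * norm (subvec (G i) x + subvec (G i) \<xi>)
              \<le> \<omega> $ i * (norm (subvec (G i) x) + norm (subvec (G i) \<xi>))"
        using \<omega> norm_triangle_ineq by (intro mult_left_mono) auto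
      then have "norm (subvec (G i) \<xi>) * norm (subvec (G i) \<xi>) \<le> \<omega> $ i * norm (subvec (G i) \<xi>)"
        using key[of i \<xi>] by (simp add: algebra_simps dot_square_norm power2_eq_square)
      then show ?thesis using False by simp
    qed (use \<omega> in simp)
    have "subvec (G i) \<xi> = (\<omega> $ i / norm (subvec (G i) x)) *\<^sub>R subvec (G i) x"
      if nz: "subvec (G i) x \<noteq> 0" for i
    proof -
      define a where "a = subvec (G i) \<xi>"
      define c where "c = subvec (G i) x"
      define w where "w = \<omega> $ i"
      have c: "norm c > 0" using nz by (simp add: c_def)
      have "subvec (G i) (- x) = - c" by (simp add: c_def subvec_def vec_eq_iff)
      then have ac: "w * norm c \<le> a \<bullet> c"
        using key[of i "- x"] by (simp add: a_def c_def w_def)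
      have na: "norm a \<le> w" using bound by (simp add: a_def w_def)
      have w: "0 \<le> w" using \<omega> by (simp add: w_def)
      have "(norm (a - (w / norm c) *\<^sub>R c))\<^sup>2
              = (norm a)\<^sup>2 - 2 * (w / norm c) * (a \<bullet> c) + ((w / norm c) * norm c)\<^sup>2"
        unfolding power2_norm_eq_inner inner_diff_left inner_diff_right power_mult_distrib
        by (simp add: inner_commute power2_eq_square)
      also have "(w / norm c) * norm c = w" using c by simp
      also have "(norm a)\<^sup>2 - 2 * (w / norm c) * (a \<bullet> c) + w\<^sup>2
                   \<le> w\<^sup>2 - 2 * (w / norm c) * (w * norm c) + w\<^sup>2"
        using na w ac c by (intro add_mono diff_mono power_mono mult_left_mono) auto
      also have "\<dots> = 0" using c by (simp add: power2_eq_square)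
      finally show ?thesis by (simp add: a_def c_def w_def)
    qed
    with bound show ?thesis by blast
  qed
  have L_if: "\<xi> \<in> ?L" if \<xi>: "\<xi> \<in> ?R" for \<xi>
  proof -
    have "weighted_norm G \<omega> x + \<xi> \<bullet> (y - x) \<le> weighted_norm G \<omega> y" for y
    proof -
      have le: "\<omega> $ i * norm (subvec (G i) x) + subvec (G i) \<xi> \<bullet> subvec (G i) (y - x)
                 \<le> \<omega> $ i * norm (subvec (G i) y)" for i
      proof (cases "subvec (G i) x = 0")
        case True
        then have "norm (subvec (G i) \<xi>) \<le> \<omega> $ i" using \<xi> by blast
        then have "norm (subvec (G i) \<xi>) * norm (subvec (G i) y) \<le> \<omega> $ i * norm (subvec (G i) y)"
          by (intro mult_right_mono) auto
        then have "subvec (G i) \<xi> \<bullet> subvec (G i) y \<le> \<omega> $ i * norm (subvec (G i) y)"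
          using norm_cauchy_schwarz order_trans by blast
        then show ?thesis using True by (simp add: subvec_minus)
      next
        case False
        define c where "c = subvec (G i) x"
        define d where "d = subvec (G i) y"
        define w where "w = \<omega> $ i"
        have c: "norm c > 0" using False by (simp add: c_def)
        have "subvec (G i) \<xi> = (w / norm c) *\<^sub>R c" using \<xi> False by (simp add: c_def w_def)
        then have "w * norm c + subvec (G i) \<xi> \<bullet> subvec (G i) (y - x)
            = w * norm c + (w / norm c) * (c \<bullet> d - (norm c)\<^sup>2)"
          by (simp add: subvec_minus inner_diff_right dot_square_norm c_def d_def diff_divide_distrib
                right_diff_distrib)
        also have "\<dots> = (w / norm c) * (c \<bullet> d)"
          using c by (simp add: field_simps power2_eq_square)
        also have "\<dots> \<le> (w / norm c) * (norm c * norm d)"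
          using \<omega> c norm_cauchy_schwarz by (intro mult_left_mono) (auto simp: w_def)
        also have "\<dots> = w * norm d" using c by simp
        finally show ?thesis by (simp add: c_def d_def w_def)
      qed
      have "\<xi> \<bullet> (y - x) = \<xi> \<bullet> (\<Sum>i\<in>UNIV. subvec (G i) (y - x))"
        by (simp add: sum_subvec[OF G])
      also have "\<dots> = (\<Sum>i\<in>UNIV. subvec (G i) \<xi> \<bullet> subvec (G i) (y - x))"
        unfolding inner_sum_right by (intro sum.cong refl inner_subvec_right)
      finally have "weighted_norm G \<omega> x + \<xi> \<bullet> (y - x) =
          (\<Sum>i\<in>UNIV. \<omega> $ i * norm (subvec (G i) x) + subvec (G i) \<xi> \<bullet> subvec (G i) (y - x))"
        by (simp add: F sum.distrib)
      also have "\<dots> \<le> weighted_norm G \<omega> y"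
        unfolding F by (intro sum_mono le)
      finally show ?thesis .
    qed
    then show ?thesis by (simp add: subdifferential_def)
  qed
  show ?thesis
    by (rule set_eqI, rule iffI) (erule R_if, erule L_if)
qed

end

theory Submission
  imports Defs
begin

text \<open>
  Concavity of \<open>\<phi>\<close> makes every iterate feasible, and concavity of \<open>\<psi>\<close> makes the objective
  decrease up to the summable errors \<open>\<mu>\<^sub>k\<close>. Hence the objective values converge, the iterates are
  bounded, and the weighted norms of \<open>x\<^sup>k\<close> and \<open>xt\<^sup>k\<^sup>+\<^sup>1\<close> agree asymptotically. The multipliers stay away
  from \<open>0\<close> because the origin is uniformly infeasible for the subproblems. The subgradient
  inequality of the subproblem then bounds \<open>\<parallel>p\<^sup>k - u\<^sup>k\<parallel>\<^sup>2 + \<sigma> - \<Phi>\<close> by a null sequence, where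
  \<open>p\<^sup>k = A\<^sub>k x\<^sup>k - b\<^sup>k\<close>. An unbounded multiplier sequence would force \<open>\<phi>'(y\<^sub>i\<^sup>2) y\<^sub>i = 0\<close> for all residuals \<open>y\<^sub>i\<close> at some accumulation point, that is,
  \<open>\<Phi> = j sup \<phi>\<close> there, which is excluded. Stationarity follows by passing to the limit in the
  subgradient inequalities.
\<close>

section \<open>Concave functions on the half-line\<close>

lemma strictly_concave_imp_concave:
  assumes "strictly_concave_on S f"
  shows "concave_on S f"
  unfolding concave_on_def convex_on_def
proof (intro conjI ballI allI impI)
  show "convex S" using assms by (simp add: strictly_concave_on_def strictly_convex_on_def)
  fix x y and u v :: real
  assume *: "x \<in> S" "y \<in> S" "0 \<le> u" "0 \<le> v" "u + v = 1"
  consider "u = 0" | "v = 0" | "x = y" | "u > 0" "v > 0" "x \<noteq> y" using * by fastforce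
  then show "- f (u *\<^sub>R x + v *\<^sub>R y) \<le> u * - f x + v * - f y"
  proof cases
    case 3
    have "u *\<^sub>R x + v *\<^sub>R x = x" "u * - f x + v * - f x = - f x"
      unfolding scaleR_add_left[symmetric] distrib_right[symmetric] *(5) by simp_all
    then show ?thesis using 3 by simp
  next
    case 4
    then show ?thesis using assms *
      by (force simp: strictly_concave_on_def strictly_convex_on_def intro: less_imp_le)
  qed (use * in auto)
qed

locale concave_half_line =
  fixes h :: "real \<Rightarrow> real" and L :: real
  assumes cont: "continuous_on {0..} h"
    and concave: "concave_on {0..} h"
    and diff: "\<And>t. t > 0 \<Longrightarrow> h differentiable (at t)"
    and lim_deriv: "(deriv h \<longlongrightarrow> L) (at_right 0)"
begin

lemma has_deriv:
  assumes "t > 0"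
  shows "(h has_real_derivative deriv h t) (at t)"
  using diff[OF assms] real_differentiable_def by (metis DERIV_imp_deriv)

lemma deriv_tangent:
  assumes "t > 0" "s \<ge> 0"
  shows "h s \<le> h t + deriv h t * (s - t)"
proof -
  have "((\<lambda>x. - h x) has_field_derivative - deriv h t) (at t within {0..})"
    by (rule has_field_derivative_at_within[OF DERIV_minus[OF has_deriv[OF assms(1)]]])
  moreover have "convex_on {0..} (\<lambda>x. - h x)" using concave by (simp add: concave_on_def)
  ultimately have "- deriv h t * (s - t) \<le> - h s - - h t"
    using assms by (intro convex_on_imp_above_tangent) auto
  then show ?thesis by (simp add: algebra_simps)
qed

lemma lim_0: "(h \<longlongrightarrow> h 0) (at_right 0)"
  using cont by (metis atLeast_iff continuous_on_def at_within_Ici_at_right order_refl)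

text \<open>Limit of \<open>deriv_tangent\<close> as the base point decreases to \<open>0\<close>,
  where \<open>h\<close> need not be differentiable from both sides.\<close>

lemma tangent_0:
  assumes "s \<ge> 0"
  shows "h s \<le> h 0 + L * s"
proof -
  have "((\<lambda>t. h t + deriv h t * (s - t)) \<longlongrightarrow> h 0 + L * (s - 0)) (at_right 0)"
    by (intro tendsto_intros lim_0 lim_deriv)
  moreover have "\<forall>\<^sub>F t in at_right 0. h s \<le> h t + deriv h t * (s - t)"
    using assms deriv_tangent by (auto simp: eventually_at_right_less eventually_at_right_field intro: exI[of _ 1])
  ultimately show ?thesis
    using tendsto_lowerbound by fastforce
qed

text \<open>By the two tangent inequalities the difference quotient at \<open>0\<close> lies between
  \<open>deriv h u\<close> and \<open>L\<close>, and \<open>deriv h u\<close> tends to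
  \<open>L\<close>.\<close>

lemma right_deriv_0: "(h has_real_derivative L) (at_right 0)"
proof -
  have "((\<lambda>u. (h u - h 0) / u) \<longlongrightarrow> L) (at_right 0)"
  proof (rule tendsto_sandwich[OF _ _ lim_deriv tendsto_const])
    show "\<forall>\<^sub>F u in at_right 0. deriv h u \<le> (h u - h 0) / u"
      using deriv_tangent[of _ 0]
      by (auto simp: eventually_at_right_field field_simps intro!: exI[of _ 1])
    show "\<forall>\<^sub>F u in at_right 0. (h u - h 0) / u \<le> L"
      using tangent_0
      by (auto simp: eventually_at_right_field field_simps intro!: exI[of _ 1])
  qed
  then show ?thesis by (simp add: has_field_derivative_iff)
qed

lemma right_deriv_eq:
  assumes "(h has_real_derivative D) (at_right t)"
  shows "right_deriv h t = D"
  unfolding right_deriv_def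
proof (rule the_equality, fact assms)
  fix E assume "(h has_real_derivative E) (at_right t)"
  then show "E = D"
    using assms tendsto_unique[of "at_right t"] by (auto simp: has_field_derivative_iff)
qed

lemma right_deriv_at_0: "right_deriv h 0 = L"
  by (rule right_deriv_eq[OF right_deriv_0])

lemma right_deriv_pos:
  assumes "t > 0"
  shows "right_deriv h t = deriv h t"
  by (rule right_deriv_eq) (rule has_field_derivative_at_within[OF has_deriv[OF assms]])

lemma has_right_deriv:
  assumes "t \<ge> 0"
  shows "(h has_real_derivative right_deriv h t) (at_right t)"
  using assms right_deriv_0 right_deriv_at_0 right_deriv_pos has_deriv has_field_derivative_at_within
  by (metis order_le_less)

lemma tangent:
  assumes "t \<ge> 0" "s \<ge> 0"
  shows "h s \<le> h t + right_deriv h t * (s - t)"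
  using assms deriv_tangent[of t s] tangent_0[of s] right_deriv_pos right_deriv_at_0
  by (cases "t = 0") auto

text \<open>Sum of the tangent inequalities taken at \<open>s\<close> and at
  \<open>t\<close>.\<close>

lemma right_deriv_antimono:
  assumes "0 \<le> s" "s \<le> t"
  shows "right_deriv h t \<le> right_deriv h s"
proof (cases "s = t")
  case False
  have "0 \<le> (right_deriv h s - right_deriv h t) * (t - s)"
    using tangent[of s t] tangent[of t s] assms by (simp add: algebra_simps)
  then show ?thesis using False assms by (simp add: zero_le_mult_iff)
qed simp

text \<open>By concavity the slope of the secant from \<open>u\<close> to a fixed \<open>z\<close>
  bounds the right derivative at \<open>u\<close> from below if \<open>z > u\<close> and from above
  if \<open>z < u\<close>. This slope is continuous in \<open>u\<close>, and a \<open>z\<close>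
  close to \<open>t\<close> makes it close to the derivative at \<open>t\<close>. At
  \<open>t = 0\<close> no point lies to the left, and monotonicity gives the upper bound.\<close>

lemma continuous_right_deriv: "continuous_on {0..} (right_deriv h)"
  unfolding continuous_on_def
proof (intro ballI)
  fix t :: real assume "t \<in> {0..}"
  then have t: "0 \<le> t" by simp
  have ht: "(h \<longlongrightarrow> h t) (at t within {0..})" using cont t by (auto simp: continuous_on_def)
  show "(right_deriv h \<longlongrightarrow> right_deriv h t) (at t within {0..})"
  proof (rule order_tendstoI)
    fix a assume "a < right_deriv h t"
    then have "\<forall>\<^sub>F z in at_right t. a < (h z - h t) / (z - t)"
      using has_right_deriv[OF t] by (simp add: has_field_derivative_iff order_tendsto_iff)
    then have "\<forall>\<^sub>F z in at_right t. a < (h z - h t) / (z - t) \<and> t < z"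
      using eventually_at_right_less eventually_conj by blast
    then obtain z where z: "a < (h z - h t) / (z - t)" "t < z"
      using eventually_happens trivial_limit_at_right_real by blast
    have "((\<lambda>u. (h z - h u) / (z - u)) \<longlongrightarrow> (h z - h t) / (z - t)) (at t within {0..})"
      using z by (intro tendsto_intros ht) auto
    then have "\<forall>\<^sub>F u in at t within {0..}. a < (h z - h u) / (z - u)"
      using z(1) by (simp add: order_tendsto_iff)
    moreover have "\<forall>\<^sub>F u in at t within {0..}. u < z"
      using z(2) tendsto_ident_at order_tendstoD(2) by blast
    moreover have "\<forall>\<^sub>F u in at t within {0..}. u \<in> {0..}"
      by (simp add: eventually_at_filter)
    ultimately show "\<forall>\<^sub>F u in at t within {0..}. a < right_deriv h u"
    proof eventually_elim
      case (elim u)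
      have "(h z - h u) / (z - u) \<le> right_deriv h u"
        using tangent[of u z] elim by (simp add: field_simps)
      then show ?case using elim by simp
    qed
  next
    fix a assume a: "right_deriv h t < a"
    show "\<forall>\<^sub>F u in at t within {0..}. right_deriv h u < a"
    proof (cases "t = 0")
      case True
      have "right_deriv h u < a" if "0 \<le> u" for u
        using right_deriv_antimono[of 0 u] that a True by simp
      then show ?thesis by (simp add: eventually_at_filter)
    next
      case False
      then have tp: "t > 0" using t by simp
      have "\<forall>\<^sub>F z in at_left t. (h z - h t) / (z - t) < a"
        using has_field_derivative_at_within[OF has_deriv[OF tp], of "{..<t}"] a right_deriv_pos[OF tp]
        by (simp add: has_field_derivative_iff order_tendsto_iff)
      moreover have "\<forall>\<^sub>F z in at_left t. 0 < z"
        using tp tendsto_ident_at order_tendstoD(1) by blast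
      moreover have "\<forall>\<^sub>F z in at_left t. z < t"
        by (simp add: eventually_at_filter)
      ultimately have "\<forall>\<^sub>F z in at_left t. (h z - h t) / (z - t) < a \<and> 0 < z \<and> z < t"
        by eventually_elim auto
      then obtain z where z: "(h z - h t) / (z - t) < a" "0 < z" "z < t"
        using eventually_happens trivial_limit_at_left_real by blast
      have "((\<lambda>u. (h z - h u) / (z - u)) \<longlongrightarrow> (h z - h t) / (z - t)) (at t within {0..})"
        using z by (intro tendsto_intros ht) auto
      then have "\<forall>\<^sub>F u in at t within {0..}. (h z - h u) / (z - u) < a"
        using z(1) by (simp add: order_tendsto_iff)
      moreover have "\<forall>\<^sub>F u in at t within {0..}. z < u"
        using z(3) tendsto_ident_at order_tendstoD(1) by blast
      ultimately show "\<forall>\<^sub>F u in at t within {0..}. right_deriv h u < a"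
      proof eventually_elim
        case (elim u)
        have "right_deriv h u \<le> (h z - h u) / (z - u)"
          using tangent[of u z] elim z by (simp add: field_simps)
        then show ?case using elim by simp
      qed
    qed
  qed
qed

lemma tendsto_right_deriv:
  assumes "(f \<longlongrightarrow> t) F" "t \<ge> 0" "\<And>z. f z \<ge> 0"
  shows "((\<lambda>z. right_deriv h (f z)) \<longlongrightarrow> right_deriv h t) F"
  using assms by (intro continuous_on_tendsto_compose[OF continuous_right_deriv]) auto

lemma tendsto_fun:
  assumes "(f \<longlongrightarrow> t) F" "t \<ge> 0" "\<And>z. f z \<ge> 0"
  shows "((\<lambda>z. h (f z)) \<longlongrightarrow> h t) F"
  using assms by (intro continuous_on_tendsto_compose[OF cont]) auto

end

section \<open>Bregman distances\<close>

text \<open>The distance \<open>D\<close> from \<open>0\<close> is continuous and positive off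
  \<open>0\<close>, so it has a positive minimum on each sphere around \<open>0\<close>. Convexity
  along rays keeps \<open>D\<close> above this minimum outside the sphere, hence small values of
  \<open>D\<close> force small norms.\<close>

lemma bregman_tendsto_zero:
  fixes f :: "'a::euclidean_space \<Rightarrow> real"
  assumes f: "continuously_differentiable f" "strictly_convex_on UNIV f"
    and lim: "\<epsilon> \<longlonglongrightarrow> 0" and le: "\<And>k. bregman f (\<xi> k) 0 \<le> \<epsilon> k"
  shows "\<xi> \<longlonglongrightarrow> 0"
proof -
  obtain g where g: "\<And>z. GDERIV f z :> g z"
    using f(1) by (auto simp: continuously_differentiable_def)
  have "gradient f 0 = g 0"
    unfolding gradient_def
  proof (rule the_equality, rule g)
    fix c assume "GDERIV f 0 :> c"
    then have "(\<lambda>h. h \<bullet> c) = (\<lambda>h. h \<bullet> g 0)"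
      using g[of 0] has_derivative_unique unfolding gderiv_def by blast
    then show "c = g 0" by (metis inner_commute vector_eq_rdot)
  qed
  define D where "D z = f z - f 0 - g 0 \<bullet> z" for z
  have D: "bregman f z 0 = D z" for z
    using \<open>gradient f 0 = g 0\<close> by (simp add: bregman_def D_def)
  have D0: "D 0 = 0" by (simp add: D_def)
  have scale: "D (t *\<^sub>R z) < t * D z" if "0 < t" "t < 1" "z \<noteq> 0" for t z
  proof -
    have "f (t *\<^sub>R z + (1 - t) *\<^sub>R 0) < t * f z + (1 - t) * f 0"
      using f(2)[unfolded strictly_convex_on_def, THEN conjunct2, rule_format, of z 0 t "1 - t"] that
      by simp
    then show ?thesis by (simp add: D_def algebra_simps)
  qed
  have contf: "continuous_on UNIV f"
    using g by (intro continuous_at_imp_continuous_on) (auto simp: gderiv_def dest: has_derivative_continuous)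
  then have cont: "continuous_on S D" for S
    unfolding D_def by (intro continuous_intros continuous_on_subset[OF contf]) auto
  have nonneg: "0 \<le> D z" for z
  proof (cases "z = 0")
    case False
    have "((\<lambda>t. f (t *\<^sub>R z)) has_derivative (\<lambda>t. (t *\<^sub>R z) \<bullet> g 0)) (at 0)"
    proof (rule has_derivative_compose[of "\<lambda>t. t *\<^sub>R z" "\<lambda>t. t *\<^sub>R z" 0 UNIV f "\<lambda>h. h \<bullet> g 0"])
      show "((\<lambda>t. t *\<^sub>R z) has_derivative (\<lambda>t. t *\<^sub>R z)) (at 0)"
        by (auto intro!: derivative_eq_intros)
      show "(f has_derivative (\<lambda>h. h \<bullet> g 0)) (at (0 *\<^sub>R z))"
        using g[of 0] by (simp add: gderiv_def)
    qed
    then have "((\<lambda>t. f (t *\<^sub>R z)) has_real_derivative (g 0 \<bullet> z)) (at 0)"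
      by (simp add: has_field_derivative_def inner_commute mult_commute_abs)
    then have "((\<lambda>t. f (t *\<^sub>R z)) has_real_derivative (g 0 \<bullet> z)) (at_right 0)"
      by (rule has_field_derivative_at_within)
    then have l: "((\<lambda>t. (f (t *\<^sub>R z) - f 0) / t) \<longlongrightarrow> g 0 \<bullet> z) (at_right 0)"
      by (simp add: has_field_derivative_iff)
    \<comment> \<open>The directional derivative is a limit of difference quotients, each of which
      is at most the one at \<open>t = 1\<close>.\<close>
    have "g 0 \<bullet> z \<le> f z - f 0"
    proof (rule tendsto_upperbound[OF l])
      show "\<forall>\<^sub>F t in at_right 0. (f (t *\<^sub>R z) - f 0) / t \<le> f z - f 0"
        using scale[of _ z] False unfolding eventually_at_right_field D_def
        by (intro exI[of _ 1]) (auto simp: field_simps less_imp_le)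
    qed simp
    then show ?thesis by (simp add: D_def)
  qed (simp add: D0)
  \<comment> \<open>Strictness at the midpoint: \<open>D (z / 2)\<close> is nonnegative and less
    than half of \<open>D z\<close>.\<close>
  have pos: "0 < D z" if "z \<noteq> 0" for z
    using scale[of "1/2" z] nonneg[of "(1/2) *\<^sub>R z"] that by simp
  show ?thesis
  proof (rule LIMSEQ_I)
    fix r :: real assume r: "0 < r"
    have ne: "sphere (0::'a) r \<noteq> {}" using r by (simp add: sphere_eq_empty)
    obtain z0 where z0: "z0 \<in> sphere 0 r" "\<And>z. z \<in> sphere 0 r \<Longrightarrow> D z0 \<le> D z"
      using continuous_attains_inf[OF compact_sphere ne cont] by blast
    have m: "0 < D z0" using pos[of z0] z0(1) r by fastforce
    have far: "D z0 \<le> D z" if "r \<le> norm z" for z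
    proof (cases "norm z = r")
      case False
      then have nz: "r < norm z" "0 < norm z" using that r by auto
      have "D z0 \<le> D ((r / norm z) *\<^sub>R z)" using r nz by (intro z0) auto
      also have "\<dots> \<le> (r / norm z) * D z" using r nz by (intro less_imp_le scale) auto
      also have "\<dots> \<le> D z" using r nz nonneg[of z] by (intro mult_left_le_one_le) auto
      finally show ?thesis .
    qed (use z0 in simp)
    obtain N where N: "\<And>k. k \<ge> N \<Longrightarrow> \<epsilon> k < D z0"
      using order_tendstoD(2)[OF lim m] by (auto simp: eventually_sequentially)
    have "norm (\<xi> k - 0) < r" if "k \<ge> N" for k
      using far[of "\<xi> k"] N[OF that] le[of k] by (fastforce simp: D)
    then show "\<exists>N. \<forall>k\<ge>N. norm (\<xi> k - 0) < r" by blast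
  qed
qed

section \<open>Matrices and weighted group norms\<close>

lemma full_rank_transpose_inj:
  fixes A :: "real ^ 'n ^ 'm"
  assumes "rank A = CARD('m)"
  shows "inj ((*v) (transpose A))"
  by (simp add: full_rank_injective[symmetric] rank_transpose assms)

text \<open>Full row rank makes \<open>A ** transpose A\<close> injective, hence invertible. With
  its inverse \<open>B\<close>, the matrix \<open>transpose A ** B\<close> is a right inverse of
  \<open>A\<close> and solves the Penrose equations.\<close>

lemma pseudoinverse_right_inverse:
  fixes A :: "real ^ 'n ^ 'm"
  assumes "rank A = CARD('m)"
  shows "A *v (pseudoinverse A *v b) = b"
proof -
  have inj: "inj ((*v) (transpose A))"
    by (rule full_rank_transpose_inj[OF assms])
  let ?M = "A ** transpose A"
  have "inj ((*v) ?M)"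
  proof (rule injI)
    fix u v assume "?M *v u = ?M *v v"
    then have "?M *v (u - v) = 0" by (simp add: matrix_vector_mult_diff_distrib)
    then have "(u - v) \<bullet> (A *v (transpose A *v (u - v))) = 0"
      by (simp only: matrix_vector_mul_assoc inner_zero_right)
    then have "(transpose A *v (u - v)) \<bullet> (transpose A *v (u - v)) = 0"
      by (simp add: dot_lmul_matrix[symmetric])
    then have "transpose A *v u = transpose A *v v"
      by (simp add: matrix_vector_mult_diff_distrib)
    then show "u = v" by (rule injD[OF inj])
  qed
  then obtain B where B: "B ** ?M = mat 1"
    by (metis matrix_left_invertible_injective)
  then have B': "?M ** B = mat 1" by (simp add: matrix_left_right_inverse)
  have symM: "transpose ?M = ?M" by (simp add: matrix_transpose_mul)
  have "transpose B ** ?M = mat 1"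
    using arg_cong[OF B', of transpose] by (simp add: matrix_transpose_mul)
  then have symB: "transpose B = B"
    by (metis B' matrix_mul_assoc matrix_mul_lid matrix_mul_rid)
  let ?X = "transpose A ** B"
  have AX: "A ** ?X = mat 1" using B' by (simp add: matrix_mul_assoc)
  have "penrose_inverse A ?X"
    unfolding penrose_inverse_def using AX
    by (auto simp: matrix_transpose_mul symB matrix_mul_assoc[symmetric])
  then have "pseudoinverse A = ?X" by (rule pseudoinverse_eqI)
  then show ?thesis by (simp add: matrix_vector_mul_assoc AX)
qed

lemma diag_matrix_mult_vec: "diag_matrix v *v w = v * w"
  by (simp add: diag_matrix_def matrix_vector_mult_def vec_eq_iff if_distrib[of "\<lambda>c. c * _"] cong: if_cong)

lemma transpose_diag_matrix: "transpose (diag_matrix v) = diag_matrix v"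
  by (simp add: diag_matrix_def transpose_def vec_eq_iff)

lemma iter_residual:
  "iter_matrix A b \<phi> z *v w - iter_rhs A b \<phi> z = iter_scale A b \<phi> z * (A *v w - b)"
  by (simp add: iter_matrix_def iter_rhs_def matrix_vector_mul_assoc[symmetric] diag_matrix_mult_vec
      right_diff_distrib)

lemma transpose_iter_matrix:
  "transpose (iter_matrix A b \<phi> z) *v u = transpose A *v (iter_scale A b \<phi> z * u)"
  by (simp only: iter_matrix_def matrix_transpose_mul matrix_vector_mul_assoc[symmetric]
      transpose_diag_matrix diag_matrix_mult_vec)

lemma transpose_mult_times:
  fixes A :: "real ^ 'n ^ 'm"
  shows "transpose A *v z = (\<Sum>i\<in>UNIV. z $ i *\<^sub>R row i A)"
  by (simp add: vec_eq_iff matrix_vector_mult_def transpose_def row_def mult.commute)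

lemma norm_subvec_le: "norm (subvec S z) \<le> norm (z :: real ^ 'n)"
  unfolding norm_vec_def by (rule L2_set_mono) (auto simp: subvec_def)

lemma weighted_norm_eq:
  assumes "\<And>i. 0 \<le> \<omega> $ i"
  shows "weighted_norm G \<omega> z = (\<Sum>i\<in>UNIV. \<omega> $ i * norm (subvec (G i) z))"
  using assms by (simp add: weighted_norm_def norm1_def group_norms_def abs_mult vector_mult_component)

lemma weighted_norm_lipschitz:
  fixes \<omega> :: "real ^ 'q"
  assumes "\<And>i. 0 \<le> \<omega> $ i" "\<And>i. \<omega> $ i \<le> c"
  shows "\<bar>weighted_norm G \<omega> z - weighted_norm G \<omega> z'\<bar> \<le> real CARD('q) * c * norm (z - z')"
proof -
  have "\<bar>weighted_norm G \<omega> z - weighted_norm G \<omega> z'\<bar>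
      \<le> (\<Sum>i\<in>UNIV. \<bar>\<omega> $ i * norm (subvec (G i) z) - \<omega> $ i * norm (subvec (G i) z')\<bar>)"
    unfolding weighted_norm_eq[OF assms(1)] sum_subtractf[symmetric] by (rule sum_abs)
  also have "\<dots> \<le> (\<Sum>i\<in>(UNIV::'q set). c * norm (z - z'))"
  proof (rule sum_mono)
    fix i
    have "\<bar>norm (subvec (G i) z) - norm (subvec (G i) z')\<bar> \<le> norm (z - z')"
      using norm_triangle_ineq3 norm_subvec_le[of "G i" "z - z'"] order_trans
      unfolding subvec_minus by blast
    then have "\<omega> $ i * \<bar>norm (subvec (G i) z) - norm (subvec (G i) z')\<bar> \<le> c * norm (z - z')"
      using assms order_trans[OF assms(1,2)] by (intro mult_mono) auto
    then show "\<bar>\<omega> $ i * norm (subvec (G i) z) - \<omega> $ i * norm (subvec (G i) z')\<bar> \<le> c * norm (z - z')"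
      using assms(1) by (simp add: right_diff_distrib[symmetric] abs_mult)
  qed
  finally show ?thesis by (simp add: mult.assoc)
qed

lemma tendsto_weighted_norm:
  fixes \<omega> :: "'a \<Rightarrow> real ^ 'q::finite"
  assumes "(\<omega> \<longlongrightarrow> c) F" "(z \<longlongrightarrow> z0) F"
  shows "((\<lambda>k. weighted_norm G (\<omega> k) (z k)) \<longlongrightarrow> weighted_norm G c z0) F"
proof -
  have "((\<lambda>k. subvec S (z k)) \<longlongrightarrow> subvec S z0) F" for S
    unfolding subvec_def by (intro vec_tendstoI) (auto intro!: tendsto_intros assms(2))
  then show ?thesis
    unfolding weighted_norm_def norm1_def vector_mult_component group_norms_def
    by (auto intro!: tendsto_intros assms(1))
qed

section \<open>Runs of the algorithm\<close>

locale algorithm_run =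
  fixes A :: "real ^ 'n ^ 'm" and b :: "real ^ 'm" and \<sigma> :: real
    and \<psi> \<phi> :: "real \<Rightarrow> real"
    and G :: "'q::finite \<Rightarrow> 'n set"
    and f :: "real ^ 'n \<Rightarrow> real"
    and \<tau> \<mu> \<epsilon> l :: "nat \<Rightarrow> real"
    and x xt \<xi> :: "nat \<Rightarrow> real ^ 'n"
    and ut :: "nat \<Rightarrow> real ^ 'm"
  assumes standing: "standing_assumptions A b \<sigma> \<psi> \<phi>"
    and partition: "group_partition G"
    and smooth: "continuously_differentiable f"
    and strict: "strictly_convex_on UNIV f"
    and generated: "generated_by_algorithm A b \<sigma> \<psi> \<phi> G f \<tau> \<mu> \<epsilon> x xt ut"
    and multiplier: "\<And>k. associated_multiplier A b \<sigma> \<psi> \<phi> G f (\<epsilon> k)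
               (x k) (xt (Suc k)) (ut (Suc k)) (\<xi> k) (l k)"
begin

text \<open>The assumptions only assert that the limit of the derivative exists; \<open>Lim\<close>
  gives it a name.\<close>

sublocale phi: concave_half_line \<phi> "Lim (at_right 0) (deriv \<phi>)"
  using standing unfolding standing_assumptions_def phi_assumption_def
  by unfold_locales (auto simp: tendsto_Lim)

sublocale psi: concave_half_line \<psi> "Lim (at_right 0) (deriv \<psi>)"
  using standing unfolding standing_assumptions_def psi_assumption_def
  by unfold_locales (auto simp: tendsto_Lim strictly_concave_imp_concave)

text \<open>Index \<open>k\<close> refers to the iteration that starts at \<open>x k\<close>, so
  \<open>u k\<close> and \<open>q k\<close> are built from the pair with index \<open>Suc k\<close>.
  The vectors \<open>p k\<close> and \<open>q k\<close> are the scaled residuals at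
  \<open>x k\<close> and at the approximate solution; \<open>g k\<close> is the subgradient part of
  \<open>\<xi> k\<close>.\<close>

definition y where "y k = A *v x k - b"
definition v where "v k = iter_scale A b \<phi> (x k)"
definition s where "s k = iter_sigma A b \<sigma> \<phi> (x k)"
definition w where "w k = iter_weight \<psi> G (x k)"
definition u where "u k = ut (Suc k)"
definition p where "p k = v k * y k"
definition q where "q k = v k * (A *v xt (Suc k) - b)"
definition g where "g k = \<xi> k - l k *\<^sub>R (transpose A *v (v k * u k))"
definition Phi where "Phi z = sum_entries \<phi> ((A *v z - b) * (A *v z - b))"
definition Psi where "Psi z = (\<Sum>i\<in>UNIV. \<psi> (norm (subvec (G i) z)))"

lemma Phi_eq: "Phi z = (\<Sum>i\<in>UNIV. \<phi> (((A *v z - b) $ i)\<^sup>2))"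
  by (simp add: Phi_def sum_entries_def vector_mult_component power2_eq_square)

lemma phi_0: "\<phi> 0 = 0"
  and psi_nonneg: "t \<ge> 0 \<Longrightarrow> \<psi> t \<ge> 0" and sigma_pos: "0 < \<sigma>"
  and sigma_less: "\<sigma> < (\<Sum>i\<in>UNIV. \<phi> ((b $ i)\<^sup>2))"
  and psi_at_top: "filterlim \<psi> at_top at_top"
  and full_rank: "rank A = CARD('m)"
  and sigma_phi_bar: "j \<in> {1..CARD('m)} \<Longrightarrow> ereal \<sigma> \<noteq> ereal (real j) * phi_bar \<phi>"
  using standing by (auto simp: standing_assumptions_def phi_assumption_def psi_assumption_def)

lemma phi_deriv_nonneg:
  assumes "t \<ge> 0"
  shows "0 \<le> right_deriv \<phi> t"
proof (cases "t = 0")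
  case True
  obtain L where "L > 0" "(deriv \<phi> \<longlongrightarrow> L) (at_right 0)"
    using standing by (auto simp: standing_assumptions_def phi_assumption_def)
  then have "0 < Lim (at_right 0) (deriv \<phi>)" by (simp add: tendsto_Lim)
  then show ?thesis using True phi.right_deriv_at_0 by simp
next
  case False
  then show ?thesis using assms phi.right_deriv_pos standing
    by (simp add: standing_assumptions_def phi_assumption_def)
qed

lemma psi_deriv_pos:
  assumes "t \<ge> 0"
  shows "0 < right_deriv \<psi> t"
proof (cases "t = 0")
  case True
  obtain L where "L > 0" "(deriv \<psi> \<longlongrightarrow> L) (at_right 0)"
    using standing by (auto simp: standing_assumptions_def psi_assumption_def)
  then have "0 < Lim (at_right 0) (deriv \<psi>)" by (simp add: tendsto_Lim)
  then show ?thesis using True psi.right_deriv_at_0 by simp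
next
  case False
  then show ?thesis using assms psi.right_deriv_pos standing
    by (simp add: standing_assumptions_def psi_assumption_def)
qed

lemma w_nth: "w k $ i = right_deriv \<psi> (norm (subvec (G i) (x k)))"
  by (simp add: w_def iter_weight_def right_deriv_entries_def group_norms_def)

lemma w_nonneg: "0 \<le> w k $ i"
  and w_le: "w k $ i \<le> right_deriv \<psi> 0"
  using psi_deriv_pos[of "norm (subvec (G i) (x k))"]
    psi.right_deriv_antimono[of 0 "norm (subvec (G i) (x k))"]
  by (auto simp: w_nth)

lemma v_nth: "v k $ i = sqrt (right_deriv \<phi> ((y k $ i)\<^sup>2))"
  by (simp add: v_def y_def iter_scale_def right_deriv_entries_def vector_mult_component power2_eq_square)

lemma v_square: "(v k $ i)\<^sup>2 = right_deriv \<phi> ((y k $ i)\<^sup>2)"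
  by (simp add: v_nth phi_deriv_nonneg)

text \<open>The square roots in the scaling make the squared norm the linear term of the expansion
  of \<open>Phi\<close> in the squared residuals.\<close>

lemma norm_scaled_square:
  "(norm (v k * z))\<^sup>2 = (\<Sum>i\<in>UNIV. right_deriv \<phi> ((y k $ i)\<^sup>2) * (z $ i)\<^sup>2)"
  unfolding power2_norm_eq_inner
  by (simp add: inner_vec_def vector_mult_component power2_eq_square[symmetric] power_mult_distrib v_square)

section \<open>Elementary properties of one iteration\<close>

lemma tau_pos: "0 < \<tau> k" and tau_lim: "\<tau> \<longlonglongrightarrow> 0" and mu_pos: "0 < \<mu> k"
  and mu_summable: "summable \<mu>" and x_0: "x 0 = pseudoinverse A *v b"
  using generated by (auto simp: generated_by_algorithm_def)

lemma step: "algorithm_step A b \<sigma> \<psi> \<phi> G f (\<tau> k) (\<mu> k) (\<epsilon> k)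
            (x k) (xt (Suc k)) (ut (Suc k)) (x (Suc k))"
  using generated by (auto simp: generated_by_algorithm_def)

lemma eps_pos: "0 < \<epsilon> k" and eps_le_s: "\<epsilon> k \<le> s k" and eps_le_tau: "\<epsilon> k \<le> \<tau> k"
  and descent: "weighted_norm G (w k) (x (Suc k)) \<le> weighted_norm G (w k) (x k) + \<mu> k"
  and residual_error: "norm (q k - u k) \<le> \<epsilon> k"
  and x_Suc: "x (Suc k) = iter_retract A b \<sigma> \<phi> (x k) (xt (Suc k))"
  using step[of k] unfolding algorithm_step_def iter_residual
  by (auto simp: s_def w_def q_def v_def u_def)

lemma s_pos: "0 < s k"
  using eps_pos[of k] eps_le_s[of k] by simp

lemma eps_lim: "\<epsilon> \<longlonglongrightarrow> 0"
  by (rule tendsto_sandwich[OF _ _ tendsto_const tau_lim])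
    (use eps_pos eps_le_tau in \<open>auto intro!: always_eventually less_imp_le\<close>)

lemma u_le: "(norm (u k))\<^sup>2 \<le> s k" and l_nonneg: "0 \<le> l k"
  and complementary: "l k \<noteq> 0 \<Longrightarrow> (norm (u k))\<^sup>2 = s k"
  and bregman_xi: "bregman f (\<xi> k) 0 \<le> \<epsilon> k"
  using multiplier[of k] unfolding associated_multiplier_def optimality_set_def transpose_iter_matrix
  by (auto simp: normal_cone_def s_def u_def split: if_splits)

lemma g_subgradient: "g k \<in> subdifferential (weighted_norm G (w k)) (xt (Suc k))"
proof -
  obtain h where "\<xi> k = h + l k *\<^sub>R (transpose A *v (v k * u k))"
    "h \<in> subdifferential (weighted_norm G (w k)) (xt (Suc k))"
    using multiplier[of k] unfolding associated_multiplier_def transpose_iter_matrix v_def u_def w_def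
    by blast
  then show ?thesis by (simp add: g_def)
qed

lemma xi_lim: "\<xi> \<longlonglongrightarrow> 0"
  by (rule bregman_tendsto_zero[OF smooth strict eps_lim bregman_xi])

section \<open>Feasibility of the iterates\<close>

lemma s_eq: "s k = \<sigma> + (norm (p k))\<^sup>2 - Phi (x k)"
  by (simp add: s_def iter_sigma_def iter_residual p_def v_def y_def Phi_def)

text \<open>Sum of the tangent inequalities for \<open>\<phi>\<close> at the squared residuals of
  \<open>x k\<close>. Consequently the constraint of the subproblem implies the original
  one.\<close>

lemma Phi_le: "Phi z \<le> \<sigma> + (norm (v k * (A *v z - b)))\<^sup>2 - s k"
proof -
  have "Phi z \<le> (\<Sum>i\<in>UNIV. \<phi> ((y k $ i)\<^sup>2)
      + right_deriv \<phi> ((y k $ i)\<^sup>2) * (((A *v z - b) $ i)\<^sup>2 - (y k $ i)\<^sup>2))"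
    unfolding Phi_eq by (intro sum_mono phi.tangent) auto
  also have "\<dots> = Phi (x k) + (norm (v k * (A *v z - b)))\<^sup>2 - (norm (p k))\<^sup>2"
    unfolding p_def norm_scaled_square Phi_eq
    by (simp add: y_def sum.distrib sum_subtractf right_diff_distrib)
  finally show ?thesis by (simp add: s_eq)
qed

text \<open>The tangent of \<open>\<phi>\<close> at a squared residual, evaluated at
  \<open>0\<close>, lies above \<open>\<phi> 0 = 0\<close>.\<close>

lemma s_le: "s k \<le> \<sigma>"
proof -
  have "(norm (p k))\<^sup>2 \<le> Phi (x k)"
    unfolding p_def norm_scaled_square Phi_eq y_def[symmetric]
    using phi.tangent[of "(y k $ i)\<^sup>2" 0 for i] by (intro sum_mono) (simp add: phi_0)
  then show ?thesis by (simp add: s_eq)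
qed

text \<open>Since \<open>\<epsilon>\<^sub>k \<le> min {\<sigma>\<^sub>k, \<tau>\<^sub>k}\<close> gives \<open>\<epsilon>\<^sub>k\<^sup>2 \<le> \<sigma>\<^sub>k \<tau>\<^sub>k\<close>, the retraction parameter tends to \<open>1\<close> even
  if \<open>\<sigma>\<^sub>k\<close> comes close to \<open>0\<close>.\<close>

lemma retraction:
  obtains t where "1 / (1 + sqrt (\<tau> k)) \<le> t" "t \<le> 1"
    "x (Suc k) = (1 - t) *\<^sub>R x 0 + t *\<^sub>R xt (Suc k)"
    "norm (v k * (A *v x (Suc k) - b)) \<le> sqrt (s k)"
proof (cases "(norm (q k))\<^sup>2 \<le> s k")
  case True
  then have xS: "x (Suc k) = xt (Suc k)"
    by (simp add: x_Suc iter_retract_def Let_def iter_residual q_def v_def s_def)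
  have "0 < sqrt (\<tau> k)" using tau_pos by simp
  then have "1 / (1 + sqrt (\<tau> k)) \<le> 1" unfolding divide_le_eq_1 by linarith
  then show ?thesis using that[of 1] xS True by (simp add: q_def real_le_rsqrt)
next
  case False
  define t where "t = sqrt (s k) / norm (q k)"
  have sp: "0 < sqrt (s k)" using s_pos by simp
  have r: "sqrt (s k) < norm (q k)" using False by (intro real_less_lsqrt) auto
  have xS: "x (Suc k) = (1 - t) *\<^sub>R x 0 + t *\<^sub>R xt (Suc k)"
    using False
    by (simp add: x_Suc iter_retract_def Let_def iter_residual q_def v_def s_def t_def x_0)
  have "\<epsilon> k * \<epsilon> k \<le> s k * \<tau> k"
    using eps_pos[of k] eps_le_s[of k] eps_le_tau[of k] by (intro mult_mono) auto
  then have "\<epsilon> k \<le> sqrt (s k) * sqrt (\<tau> k)"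
    by (simp add: real_sqrt_mult[symmetric] real_le_rsqrt power2_eq_square)
  moreover have "norm (u k) \<le> sqrt (s k)" using u_le by (simp add: real_le_rsqrt)
  moreover have "norm (q k) \<le> norm (u k) + norm (q k - u k)"
    using norm_triangle_ineq[of "u k" "q k - u k"] by simp
  ultimately have "norm (q k) \<le> sqrt (s k) * (1 + sqrt (\<tau> k))"
    using residual_error[of k] by (simp add: distrib_left)
  moreover have "0 < 1 + sqrt (\<tau> k)" using tau_pos[of k] by (simp add: add_pos_pos)
  ultimately have t1: "1 / (1 + sqrt (\<tau> k)) \<le> t"
    using sp order_less_trans[OF sp r] by (simp add: t_def divide_le_eq le_divide_eq mult.commute)
  have t2: "t \<le> 1" "0 \<le> t" using sp order_less_trans[OF sp r] r by (auto simp: t_def divide_le_eq_1)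
  \<comment> \<open>Since \<open>x 0\<close> solves the linear system exactly, moving towards it
    just scales the residual by \<open>t\<close>; the choice of \<open>t\<close> then gives the
    scaled residual the norm \<open>sqrt (s k)\<close>.\<close>
  have "A *v x (Suc k) - b = t *\<^sub>R (A *v xt (Suc k) - b)"
    by (simp add: xS x_0 matrix_vector_right_distrib matrix_vector_mult_scaleR
        pseudoinverse_right_inverse[OF full_rank] algebra_simps)
  then have "v k * (A *v x (Suc k) - b) = t *\<^sub>R q k"
    by (simp add: q_def)
  then have "norm (v k * (A *v x (Suc k) - b)) = sqrt (s k)"
    using t2 sp order_less_trans[OF sp r] by (simp add: t_def)
  then show ?thesis using that[OF t1 t2(1) xS] by simp
qed

text \<open>The starting point has zero residual, and every later iterate satisfies the constraint
  of its subproblem by the retraction.\<close>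

lemma feasible: "Phi (x k) \<le> \<sigma>"
proof (cases k)
  case 0
  then show ?thesis
    using sigma_pos by (simp add: Phi_eq x_0 pseudoinverse_right_inverse[OF full_rank] phi_0)
next
  case (Suc j)
  have "norm (v j * (A *v x (Suc j) - b)) \<le> sqrt (s j)" by (rule retraction[of j])
  then have "(norm (v j * (A *v x (Suc j) - b)))\<^sup>2 \<le> s j"
    using s_pos[of j] by (metis less_imp_le norm_ge_zero power_mono real_sqrt_pow2)
  then show ?thesis using Phi_le[of "x (Suc j)" j] Suc by simp
qed

text \<open>Both differences are multiples of \<open>xt (Suc k) - x 0\<close>, with factors
  \<open>1 - t\<close> and \<open>t\<close>, whose ratio is at most \<open>sqrt (\<tau> k)\<close>.
  The bound involves only the iterates, whose boundedness is obtained from the objective.\<close>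

lemma xt_minus_x: "norm (xt (Suc k) - x (Suc k)) \<le> sqrt (\<tau> k) * norm (x (Suc k) - x 0)"
proof -
  obtain t where t: "1 / (1 + sqrt (\<tau> k)) \<le> t" "t \<le> 1"
    "x (Suc k) = (1 - t) *\<^sub>R x 0 + t *\<^sub>R xt (Suc k)" by (rule retraction[of k])
  have T: "0 < sqrt (\<tau> k)" using tau_pos by simp
  then have tp: "0 < t" using t(1) by (smt (verit) divide_pos_pos)
  have "1 - t \<le> sqrt (\<tau> k) * t" using t(1) T by (simp add: field_simps)
  then have "(1 - t) * norm (xt (Suc k) - x 0) \<le> sqrt (\<tau> k) * t * norm (xt (Suc k) - x 0)"
    by (rule mult_right_mono) simp
  moreover have "xt (Suc k) - x (Suc k) = (1 - t) *\<^sub>R (xt (Suc k) - x 0)"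
    "x (Suc k) - x 0 = t *\<^sub>R (xt (Suc k) - x 0)"
    unfolding t(3) by (simp_all add: algebra_simps)
  ultimately show ?thesis using t(2) tp by (simp add: mult.assoc)
qed

section \<open>Descent of the objective and boundedness of the iterates\<close>

text \<open>The weights are the slopes of \<open>\<psi>\<close> at the current group norms, so
  concavity provides a majorant of the objective.\<close>

lemma Psi_step: "Psi z \<le> Psi (x k) + weighted_norm G (w k) z - weighted_norm G (w k) (x k)"
proof -
  have "Psi z \<le> (\<Sum>i\<in>UNIV. \<psi> (norm (subvec (G i) (x k)))
      + w k $ i * (norm (subvec (G i) z) - norm (subvec (G i) (x k))))"
    unfolding Psi_def w_nth by (intro sum_mono psi.tangent) auto
  then show ?thesis
    by (simp add: Psi_def weighted_norm_eq w_nonneg sum.distrib sum_subtractf right_diff_distrib)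
qed

lemma Psi_nonneg: "0 \<le> Psi z"
  unfolding Psi_def by (intro sum_nonneg psi_nonneg) simp

text \<open>Subtracting the partial sums of \<open>\<mu>\<close> leaves a decreasing sequence, which
  is bounded below by \<open>- suminf \<mu>\<close>.\<close>

lemma Psi_convergent: "convergent (\<lambda>k. Psi (x k))"
proof -
  define a where "a k = Psi (x k) - (\<Sum>j<k. \<mu> j)" for k
  have "decseq a"
    unfolding decseq_Suc_iff a_def using Psi_step descent by (smt (verit) sum.lessThan_Suc)
  moreover have "- suminf \<mu> \<le> a k" for k
    using Psi_nonneg[of "x k"] sum_le_suminf[OF mu_summable, of "{..<k}"] mu_pos
    by (simp add: a_def less_imp_le)
  ultimately obtain c where "a \<longlonglongrightarrow> c" using decseq_convergent by blast
  then have "(\<lambda>k. a k + (\<Sum>j<k. \<mu> j)) \<longlonglongrightarrow> c + suminf \<mu>"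
    using summable_LIMSEQ[OF mu_summable] by (rule tendsto_add)
  then show ?thesis by (auto simp: a_def convergent_def)
qed

text \<open>Convergence bounds the objective values, and since \<open>\<psi>\<close> tends to
  infinity this bounds every group norm.\<close>

lemma x_bounded: obtains R where "\<And>k. norm (x k) \<le> R" "0 \<le> R"
proof -
  obtain C where C: "\<And>k. Psi (x k) \<le> C"
    using Bseq_bdd_above[OF convergent_imp_Bseq[OF Psi_convergent]] by (auto simp: bdd_above_def)
  obtain r where r: "\<And>t. t \<ge> r \<Longrightarrow> C < \<psi> t"
    using psi_at_top by (auto simp: filterlim_at_top_dense eventually_at_top_linorder)
  have "norm (subvec (G i) (x k)) \<le> r" for i k
  proof (rule ccontr)
    assume "\<not> ?thesis"
    then have "C < \<psi> (norm (subvec (G i) (x k)))" using r by simp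
    also have "\<dots> \<le> Psi (x k)"
      unfolding Psi_def by (rule member_le_sum) (auto simp: psi_nonneg)
    finally show False using C[of k] by simp
  qed
  then have "(\<Sum>i\<in>UNIV. norm (subvec (G i) (x k))) \<le> real CARD('q) * r" for k
    by (rule sum_bounded_above)
  moreover have "norm (x k) \<le> (\<Sum>i\<in>UNIV. norm (subvec (G i) (x k)))" for k
    using norm_sum[of "\<lambda>i. subvec (G i) (x k)" UNIV] by (simp add: sum_subvec[OF partition])
  ultimately have bound: "norm (x k) \<le> real CARD('q) * r" for k
    using order_trans by blast
  show ?thesis by (rule that[OF bound order_trans[OF norm_ge_zero bound]])
qed

lemma norm_u_le: "norm (u k) \<le> sqrt (s k)"
  using u_le by (simp add: real_le_rsqrt)

lemma norm_u_le_sigma: "norm (u k) \<le> sqrt \<sigma>"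
  using norm_u_le s_le real_sqrt_le_mono order_trans by blast

lemma x_differences_bounded: obtains R where "\<And>k. norm (x k - x 0) \<le> R"
proof -
  obtain R where "\<And>k. norm (x k) \<le> R" by (rule x_bounded) blast
  then have "norm (x k - x 0) \<le> R + R" for k
    using norm_triangle_ineq4[of "x k" "x 0"] by (meson add_mono order_trans)
  then show ?thesis using that by blast
qed

lemma xt_minus_x_lim: "(\<lambda>k. xt (Suc k) - x (Suc k)) \<longlonglongrightarrow> 0"
proof -
  obtain R where R: "\<And>k. norm (x k - x 0) \<le> R" by (rule x_differences_bounded) blast
  show ?thesis
  proof (rule Lim_null_comparison)
    have "norm (xt (Suc k) - x (Suc k)) \<le> sqrt (\<tau> k) * R" for k
      by (rule order_trans[OF xt_minus_x mult_left_mono[OF R]]) (simp add: less_imp_le[OF tau_pos])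
    then show "\<forall>\<^sub>F k in sequentially. norm (xt (Suc k) - x (Suc k)) \<le> sqrt (\<tau> k) * R"
      by simp
    show "(\<lambda>k. sqrt (\<tau> k) * R) \<longlonglongrightarrow> 0"
      using tendsto_mult_left_zero[OF tendsto_real_sqrt[OF tau_lim, simplified]] .
  qed
qed

lemma xt_step_bounded: obtains R where "\<And>k. norm (xt (Suc k) - x k) \<le> R"
proof -
  obtain R1 where R1: "\<And>k. norm (xt (Suc k) - x (Suc k)) \<le> R1"
    using convergent_imp_Bseq[OF convergentI[OF xt_minus_x_lim]] by (auto simp: Bseq_def)
  obtain R where R: "\<And>k. norm (x k - x 0) \<le> R" by (rule x_differences_bounded) blast
  have "norm (xt (Suc k) - x k) \<le> R1 + R + R" for k
    using R1[of k] R[of k] R[of "Suc k"]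
      norm_triangle_ineq[of "xt (Suc k) - x (Suc k)" "x (Suc k) - x k"]
      norm_triangle_ineq4[of "x (Suc k) - x 0" "x k - x 0"] by simp
  then show ?thesis using that by blast
qed

text \<open>Between \<open>x k\<close> and \<open>x (Suc k)\<close> the gap lies between
  \<open>- \<mu> k\<close> and the decrease of the convergent objective. Passing from
  \<open>x (Suc k)\<close> to \<open>xt (Suc k)\<close> costs a null sequence by the uniform
  Lipschitz bound.\<close>

lemma weighted_gap_lim:
  "(\<lambda>k. weighted_norm G (w k) (x k) - weighted_norm G (w k) (xt (Suc k))) \<longlonglongrightarrow> 0"
proof -
  have "(\<lambda>k. weighted_norm G (w k) (x k) - weighted_norm G (w k) (x (Suc k))) \<longlonglongrightarrow> 0"
  proof (rule tendsto_sandwich)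
    show "(\<lambda>k. - \<mu> k) \<longlonglongrightarrow> 0" using tendsto_minus[OF summable_LIMSEQ_zero[OF mu_summable]] by simp
    obtain c where c: "(\<lambda>k. Psi (x k)) \<longlonglongrightarrow> c" using Psi_convergent by (auto simp: convergent_def)
    show "(\<lambda>k. Psi (x k) - Psi (x (Suc k))) \<longlonglongrightarrow> 0"
      using tendsto_diff[OF c LIMSEQ_Suc[OF c]] by simp
    show "\<forall>\<^sub>F k in sequentially. - \<mu> k \<le> weighted_norm G (w k) (x k) - weighted_norm G (w k) (x (Suc k))"
      using descent by (intro always_eventually allI) (smt (verit))
    show "\<forall>\<^sub>F k in sequentially. weighted_norm G (w k) (x k) - weighted_norm G (w k) (x (Suc k))
        \<le> Psi (x k) - Psi (x (Suc k))"
      using Psi_step by (intro always_eventually allI) (smt (verit))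
  qed
  moreover have "(\<lambda>k. weighted_norm G (w k) (x (Suc k)) - weighted_norm G (w k) (xt (Suc k))) \<longlonglongrightarrow> 0"
  proof (rule Lim_null_comparison)
    let ?C = "real CARD('q) * right_deriv \<psi> 0"
    show "\<forall>\<^sub>F k in sequentially. norm (weighted_norm G (w k) (x (Suc k))
        - weighted_norm G (w k) (xt (Suc k))) \<le> ?C * norm (xt (Suc k) - x (Suc k))"
      unfolding real_norm_def norm_minus_commute[of "xt _"]
      by (intro always_eventually allI weighted_norm_lipschitz w_nonneg w_le)
    show "(\<lambda>k. ?C * norm (xt (Suc k) - x (Suc k))) \<longlonglongrightarrow> 0"
      using tendsto_mult_right_zero[OF tendsto_norm_zero[OF xt_minus_x_lim]] .
  qed
  ultimately have "(\<lambda>k. (weighted_norm G (w k) (x k) - weighted_norm G (w k) (x (Suc k)))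
      + (weighted_norm G (w k) (x (Suc k)) - weighted_norm G (w k) (xt (Suc k)))) \<longlonglongrightarrow> 0"
    using tendsto_add_zero by blast
  then show ?thesis by simp
qed

lemma xi_step_lim: "(\<lambda>k. \<xi> k \<bullet> (xt (Suc k) - x k)) \<longlonglongrightarrow> 0"
proof -
  obtain R where R: "\<And>k. norm (xt (Suc k) - x k) \<le> R" by (rule xt_step_bounded) blast
  show ?thesis
  proof (rule Lim_null_comparison)
    have "norm (\<xi> k \<bullet> (xt (Suc k) - x k)) \<le> norm (\<xi> k) * R" for k
      using Cauchy_Schwarz_ineq2[of "\<xi> k"] mult_left_mono[OF R[of k], of "norm (\<xi> k)"]
      by (smt (verit) norm_ge_zero real_norm_def)
    then show "\<forall>\<^sub>F k in sequentially. norm (\<xi> k \<bullet> (xt (Suc k) - x k)) \<le> norm (\<xi> k) * R"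
      by simp
    show "(\<lambda>k. norm (\<xi> k) * R) \<longlonglongrightarrow> 0"
      using tendsto_mult_left_zero[OF tendsto_norm_zero[OF xi_lim]] .
  qed
qed

section \<open>The optimality gap of the subproblem\<close>

lemma inner_times_vec: "a \<bullet> (c * d) = (c * a) \<bullet> d" for a c d :: "real ^ 'k"
  by (simp add: inner_vec_def vector_mult_component mult_ac)

lemma inner_transpose_A: "(transpose A *v z) \<bullet> a = z \<bullet> (A *v a)"
  by (simp add: dot_lmul_matrix[symmetric])

lemma p_minus_q: "p k - q k = v k * (A *v (x k - xt (Suc k)))"
  by (simp add: p_def q_def y_def matrix_vector_mult_diff_distrib algebra_simps)

lemma g_inner: "g k \<bullet> (x k - xt (Suc k)) = - (\<xi> k \<bullet> (xt (Suc k) - x k)) - l k * (u k \<bullet> (p k - q k))"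
  unfolding p_minus_q inner_times_vec inner_transpose_A[symmetric] g_def
  by (simp add: inner_diff_left inner_diff_right matrix_vector_mult_diff_distrib algebra_simps)

text \<open>The subgradient inequality between \<open>x\<^sup>k\<close> and the approximate solution of the subproblem,
  in which strong convexity of the squared residual produces a quadratic term.\<close>

lemma subproblem_gap:
  assumes "0 < l k"
  shows "l k * ((norm (p k - u k))\<^sup>2 / 2 + (\<sigma> - Phi (x k)) / 2 + u k \<bullet> (q k - u k))
    \<le> weighted_norm G (w k) (x k) - weighted_norm G (w k) (xt (Suc k)) + \<xi> k \<bullet> (xt (Suc k) - x k)"
proof -
  have "weighted_norm G (w k) (x k) \<ge> weighted_norm G (w k) (xt (Suc k)) + g k \<bullet> (x k - xt (Suc k))"
    using g_subgradient by (simp add: subdifferential_def)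
  \<comment> \<open>A positive multiplier makes the constraint active, so the squared norm of
    \<open>u k\<close> is \<open>s k\<close>. With \<open>s_eq\<close>, the first two summands add
    up to \<open>s k\<close> minus the inner product of \<open>u k\<close> and
    \<open>p k\<close>.\<close>
  moreover have "(norm (p k - u k))\<^sup>2 / 2 + (\<sigma> - Phi (x k)) / 2 + u k \<bullet> (q k - u k) = - (u k \<bullet> (p k - q k))"
  proof -
    have "(norm (p k - u k))\<^sup>2 = (norm (p k))\<^sup>2 + (norm (u k))\<^sup>2 - 2 * (u k \<bullet> p k)"
      by (simp add: power2_norm_eq_inner inner_diff_left inner_diff_right inner_commute)
    moreover have "u k \<bullet> u k = s k" using complementary[of k] assms by (simp add: dot_square_norm)
    ultimately show ?thesis using s_eq[of k] complementary[of k] assms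
      by (simp add: inner_diff_right field_simps)
  qed
  ultimately show ?thesis by (simp add: g_inner)
qed

section \<open>Lower bound for the multipliers\<close>

text \<open>The group norms stay below some \<open>R\<close>, and the decreasing right derivative of
  \<open>\<psi>\<close> is still positive at \<open>R\<close>.\<close>

lemma w_bounded_below: obtains c where "0 < c" "\<And>k i. c \<le> w k $ i"
proof -
  obtain R where R: "\<And>k. norm (x k) \<le> R" "0 \<le> R" by (rule x_bounded) blast
  have "right_deriv \<psi> R \<le> w k $ i" for k i
    unfolding w_nth using norm_subvec_le order_trans[OF _ R(1)]
    by (intro psi.right_deriv_antimono) auto
  then show ?thesis using that psi_deriv_pos[OF R(2)] by blast
qed

lemma norm_v_times_le: "norm (v k * z) \<le> sqrt (right_deriv \<phi> 0) * norm z"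
proof -
  have "(norm (v k * z))\<^sup>2 \<le> (\<Sum>i\<in>UNIV. right_deriv \<phi> 0 * (z $ i)\<^sup>2)"
    unfolding norm_scaled_square
    by (intro sum_mono mult_right_mono phi.right_deriv_antimono) auto
  also have "\<dots> = right_deriv \<phi> 0 * (norm z)\<^sup>2"
    unfolding power2_norm_eq_inner inner_vec_def by (simp add: sum_distrib_left power2_eq_square)
  finally show ?thesis
    by (metis real_le_rsqrt real_sqrt_mult real_sqrt_abs abs_norm_cancel)
qed

lemma transpose_bounded: obtains K where "0 < K" "\<And>k. norm (transpose A *v (v k * u k)) \<le> K"
proof -
  obtain K where K: "0 < K" "\<And>z. norm (transpose A *v z) \<le> norm z * K"
    using bounded_linear.pos_bounded[OF matrix_vector_mul_bounded_linear] by blast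
  let ?B = "sqrt (right_deriv \<phi> 0) * sqrt \<sigma>"
  have B: "0 \<le> ?B" using phi_deriv_nonneg[of 0] sigma_pos by simp
  have "norm (v k * u k) \<le> ?B" for k
    using norm_v_times_le[of k "u k"] mult_left_mono[OF norm_u_le_sigma[of k], of "sqrt (right_deriv \<phi> 0)"]
      phi_deriv_nonneg[of 0] by simp
  then have "norm (v k * u k) * K \<le> ?B * K" for k
    using K(1) by (simp add: mult_right_mono)
  \<comment> \<open>The summand \<open>1\<close> makes the bound positive, since a later threshold
    divides by it.\<close>
  then have "norm (transpose A *v (v k * u k)) \<le> ?B * K + 1" for k
    using K(2)[of "v k * u k"] by (smt (verit))
  moreover have "0 < ?B * K + 1" using B K(1) by (simp add: add_nonneg_pos)
  ultimately show ?thesis using that by blast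
qed

text \<open>On a nonzero group the subgradient has norm exactly equal to the weight.\<close>

lemma zero_if_small_subgradient:
  assumes "\<And>i. norm (g k) < w k $ i"
  shows "xt (Suc k) = 0"
proof -
  have "subvec (G i) (xt (Suc k)) = 0" for i
  proof (rule ccontr)
    assume nz: "subvec (G i) (xt (Suc k)) \<noteq> 0"
    then have "subvec (G i) (g k) = (w k $ i / norm (subvec (G i) (xt (Suc k)))) *\<^sub>R subvec (G i) (xt (Suc k))"
      using g_subgradient[of k] unfolding subdifferential_weighted_norm[OF partition w_nonneg] by blast
    then have "norm (subvec (G i) (g k)) = w k $ i" using nz w_nonneg by simp
    then show False using norm_subvec_le[of "G i" "g k"] assms[of i] by simp
  qed
  then show ?thesis using sum_subvec[OF partition, of "xt (Suc k)"] by simp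
qed

text \<open>A small multiplier would make the subgradient \<open>g k\<close> small and hence \<open>xt (Suc k) = 0\<close>, but \<open>0\<close>
  violates the constraint of the subproblem by a fixed amount.\<close>

lemma l_bounded_below: obtains c where "0 < c" "\<forall>\<^sub>F k in sequentially. c \<le> l k"
proof -
  obtain c where c: "0 < c" "\<And>k i. c \<le> w k $ i" by (rule w_bounded_below) blast
  obtain K where K: "0 < K" "\<And>k. norm (transpose A *v (v k * u k)) \<le> K" by (rule transpose_bounded) blast
  define \<beta> where "\<beta> = Phi 0 - \<sigma>"
  have \<beta>: "0 < \<beta>" using sigma_less by (simp add: \<beta>_def Phi_eq)
  have "(\<lambda>k. norm (\<xi> k)) \<longlonglongrightarrow> 0" by (rule tendsto_norm_zero[OF xi_lim])
  then have "\<forall>\<^sub>F k in sequentially. norm (\<xi> k) < c / 2" using c(1) by (intro order_tendstoD(2)) auto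
  \<comment> \<open>This sequence bounds the excess of the squared residual over \<open>s k\<close>
    when the residual has norm at most \<open>sqrt (s k) + \<epsilon> k\<close>.\<close>
  moreover have "(\<lambda>k. 2 * sqrt \<sigma> * \<epsilon> k + (\<epsilon> k)\<^sup>2) \<longlonglongrightarrow> 2 * sqrt \<sigma> * 0 + 0\<^sup>2"
    by (intro tendsto_intros eps_lim)
  then have "\<forall>\<^sub>F k in sequentially. 2 * sqrt \<sigma> * \<epsilon> k + (\<epsilon> k)\<^sup>2 < \<beta>"
    using \<beta> by (simp add: order_tendsto_iff)
  \<comment> \<open>Below this threshold the multiplier term contributes at most
    \<open>c / 2\<close> to the norm of \<open>g k\<close>, and \<open>\<xi> k\<close> contributes
    less than \<open>c / 2\<close>.\<close>
  ultimately have "\<forall>\<^sub>F k in sequentially. c / (2 * K) \<le> l k"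
  proof eventually_elim
    case (elim k)
    show ?case
    proof (rule ccontr)
      assume "\<not> ?case"
      then have "l k * K \<le> c / 2" using K(1) by (simp add: field_simps)
      moreover have "norm (l k *\<^sub>R (transpose A *v (v k * u k))) \<le> l k * K"
        using K(2)[of k] l_nonneg[of k] by (simp add: mult_left_mono)
      ultimately have "norm (g k) < c"
        using norm_triangle_ineq4[of "\<xi> k" "l k *\<^sub>R (transpose A *v (v k * u k))"] elim(1)
        unfolding g_def by linarith
      then have "xt (Suc k) = 0"
        using c(2) by (intro zero_if_small_subgradient) (rule order_less_le_trans)
      then have "Phi 0 \<le> \<sigma> + (norm (q k))\<^sup>2 - s k" using Phi_le[of 0 k] by (simp add: q_def)
      moreover have "norm (q k) \<le> sqrt (s k) + \<epsilon> k"
        using norm_triangle_ineq[of "u k" "q k - u k"] norm_u_le[of k] residual_error[of k] by simp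
      then have "(norm (q k))\<^sup>2 \<le> (sqrt (s k) + \<epsilon> k)\<^sup>2" by (intro power_mono) auto
      then have "(norm (q k))\<^sup>2 \<le> s k + 2 * sqrt (s k) * \<epsilon> k + (\<epsilon> k)\<^sup>2"
        using s_pos[of k] by (simp add: power2_sum)
      moreover have "2 * sqrt (s k) * \<epsilon> k \<le> 2 * sqrt \<sigma> * \<epsilon> k"
        using s_le[of k] eps_pos[of k] by simp
      ultimately show False using elim(2) by (simp add: \<beta>_def)
    qed
  qed
  moreover have "0 < c / (2 * K)" using c(1) K(1) by simp
  ultimately show ?thesis using that by blast
qed

text \<open>Dividing the gap inequality by \<open>l k\<close>, which is bounded away from \<open>0\<close>, makes the limits
  independent of whether the multipliers are bounded.\<close>

lemma gap_lims:
  shows p_minus_u_lim: "(\<lambda>k. p k - u k) \<longlonglongrightarrow> 0"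
    and Phi_lim: "(\<lambda>k. Phi (x k)) \<longlonglongrightarrow> \<sigma>"
proof -
  obtain c where c: "0 < c" "\<forall>\<^sub>F k in sequentially. c \<le> l k" by (rule l_bounded_below)
  define D where "D k = weighted_norm G (w k) (x k) - weighted_norm G (w k) (xt (Suc k))
    + \<xi> k \<bullet> (xt (Suc k) - x k)" for k
  have D: "D \<longlonglongrightarrow> 0"
    unfolding D_def using tendsto_add_zero[OF weighted_gap_lim xi_step_lim] .
  define h where "h k = 2 * (\<bar>D k\<bar> / c + sqrt \<sigma> * \<epsilon> k)" for k
  have "h \<longlonglongrightarrow> 2 * (\<bar>0\<bar> / c + sqrt \<sigma> * 0)"
    unfolding h_def using c(1) by (intro tendsto_intros D eps_lim) auto
  then have h: "h \<longlonglongrightarrow> 0" by simp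
  have le: "\<forall>\<^sub>F k in sequentially. (norm (p k - u k))\<^sup>2 + (\<sigma> - Phi (x k)) \<le> h k"
    using c(2)
  proof eventually_elim
    case (elim k)
    let ?L = "(norm (p k - u k))\<^sup>2 / 2 + (\<sigma> - Phi (x k)) / 2 + u k \<bullet> (q k - u k)"
    have lk: "0 < l k" using elim c(1) by simp
    have "l k * ?L \<le> \<bar>D k\<bar>" using subproblem_gap[OF lk] by (simp add: D_def)
    then have "?L \<le> \<bar>D k\<bar> / l k" using lk by (simp add: field_simps)
    also have "\<dots> \<le> \<bar>D k\<bar> / c" using elim c(1) by (intro divide_left_mono) auto
    finally have "?L \<le> \<bar>D k\<bar> / c" .
    moreover have "\<bar>u k \<bullet> (q k - u k)\<bar> \<le> norm (u k) * norm (q k - u k)" by (rule Cauchy_Schwarz_ineq2)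
    moreover have "norm (u k) * norm (q k - u k) \<le> sqrt \<sigma> * \<epsilon> k"
      using norm_u_le_sigma residual_error sigma_pos by (intro mult_mono) auto
    moreover have "a + b \<le> 2 * (d + m)" if "a / 2 + b / 2 + e \<le> d" "\<bar>e\<bar> \<le> n" "n \<le> m"
      for a b d e m n :: real using that by (simp add: field_simps)
    ultimately show ?case unfolding h_def by blast
  qed
  \<comment> \<open>By feasibility both summands in \<open>le\<close> are nonnegative, so
    \<open>h\<close> dominates each of them separately.\<close>
  have "(\<lambda>k. (norm (p k - u k))\<^sup>2) \<longlonglongrightarrow> 0"
  proof (rule tendsto_sandwich[OF _ _ tendsto_const h])
    show "\<forall>\<^sub>F k in sequentially. (norm (p k - u k))\<^sup>2 \<le> h k"
      using le by eventually_elim (smt (verit) feasible)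
  qed simp
  then have "(\<lambda>k. sqrt ((norm (p k - u k))\<^sup>2)) \<longlonglongrightarrow> sqrt 0" by (rule tendsto_real_sqrt)
  then show "(\<lambda>k. p k - u k) \<longlonglongrightarrow> 0" by (simp add: tendsto_norm_zero_iff)
  have "(\<lambda>k. \<sigma> - Phi (x k)) \<longlonglongrightarrow> 0"
  proof (rule tendsto_sandwich[OF _ _ tendsto_const h])
    show "\<forall>\<^sub>F k in sequentially. \<sigma> - Phi (x k) \<le> h k"
      using le by eventually_elim (smt (verit) zero_le_power2)
  qed (simp add: feasible)
  from tendsto_diff[OF tendsto_const[of \<sigma>] this] show "(\<lambda>k. Phi (x k)) \<longlonglongrightarrow> \<sigma>" by simp
qed

lemma q_minus_u_lim: "(\<lambda>k. q k - u k) \<longlonglongrightarrow> 0"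
  by (rule Lim_null_comparison[OF _ eps_lim]) (simp add: residual_error)

lemma p_minus_q_lim: "(\<lambda>k. p k - q k) \<longlonglongrightarrow> 0"
  using tendsto_diff[OF p_minus_u_lim q_minus_u_lim] by simp

lemma v_p_nth: "(v k * p k) $ i = right_deriv \<phi> ((y k $ i)\<^sup>2) * y k $ i"
  unfolding v_square[symmetric] by (simp add: p_def vector_mult_component power2_eq_square)

lemma scaled_v_lim:
  assumes "z \<longlonglongrightarrow> 0"
  shows "(\<lambda>k. v k * z k) \<longlonglongrightarrow> 0"
proof (rule Lim_null_comparison)
  show "\<forall>\<^sub>F k in sequentially. norm (v k * z k) \<le> sqrt (right_deriv \<phi> 0) * norm (z k)"
    by (simp add: norm_v_times_le)
  show "(\<lambda>k. sqrt (right_deriv \<phi> 0) * norm (z k)) \<longlonglongrightarrow> 0"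
    by (rule tendsto_mult_right_zero[OF tendsto_norm_zero[OF assms]])
qed

text \<open>A second multiplication by \<open>v k\<close> turns the square roots in
  \<open>p k - q k\<close> into the right derivatives of \<open>\<phi>\<close>, up to sign.\<close>

lemma scaled_step_lim:
  "(\<lambda>k. right_deriv \<phi> ((row i A \<bullet> x k - b $ i)\<^sup>2) * (row i A \<bullet> (xt (Suc k) - x k))) \<longlonglongrightarrow> 0"
proof -
  have row: "row i A \<bullet> z = (A *v z) $ i" for z
    by (simp add: matrix_mult_dot row_def)
  have "(\<lambda>k. (v k * (p k - q k)) $ i) \<longlonglongrightarrow> 0 $ i"
    by (intro tendsto_intros scaled_v_lim p_minus_q_lim)
  then have "(\<lambda>k. - (v k * (p k - q k)) $ i) \<longlonglongrightarrow> 0"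
    using tendsto_minus by fastforce
  moreover have "- (v k * (p k - q k)) $ i
      = right_deriv \<phi> ((row i A \<bullet> x k - b $ i)\<^sup>2) * (row i A \<bullet> (xt (Suc k) - x k))" for k
    using v_square[of k i]
    by (simp add: p_minus_q vector_mult_component row y_def matrix_vector_mult_diff_distrib
        power2_eq_square algebra_simps)
  ultimately show ?thesis by simp
qed

text \<open>\<open>2 *\<^sub>R (transpose A *v e z)\<close> is the gradient of \<open>Phi\<close> at \<open>z\<close>.\<close>

definition e where
  "e z = (\<chi> i. right_deriv \<phi> (((A *v z - b) $ i)\<^sup>2) * (A *v z - b) $ i)"

section \<open>Limits along subsequences\<close>

lemma tendsto_residual:
  assumes "(z \<longlongrightarrow> z0) F"
  shows "((\<lambda>n. (A *v z n - b) $ i) \<longlongrightarrow> (A *v z0 - b) $ i) F"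
  by (intro tendsto_intros assms bounded_linear.tendsto[OF matrix_vector_mul_bounded_linear])

lemma tendsto_Phi:
  assumes "(z \<longlongrightarrow> z0) F"
  shows "((\<lambda>n. Phi (z n)) \<longlongrightarrow> Phi z0) F"
  unfolding Phi_eq
  by (intro tendsto_sum phi.tendsto_fun tendsto_power tendsto_residual assms) auto

lemma tendsto_e:
  assumes "(z \<longlongrightarrow> z0) F"
  shows "((\<lambda>n. e (z n)) \<longlongrightarrow> e z0) F"
  unfolding e_def
  by (intro vec_tendstoI)
    (auto intro!: tendsto_mult phi.tendsto_right_deriv tendsto_power tendsto_residual assms
      simp del: vector_minus_component)

lemma v_p_eq: "v k * p k = e (x k)"
  unfolding vec_eq_iff v_p_nth by (simp add: e_def y_def)

lemma tendsto_iter_weight: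
  assumes "(z \<longlongrightarrow> z0) F"
  shows "((\<lambda>n. iter_weight \<psi> G (z n)) \<longlongrightarrow> iter_weight \<psi> G z0) F"
proof -
  have "((\<lambda>n. subvec S (z n)) \<longlongrightarrow> subvec S z0) F" for S
    unfolding subvec_def by (intro vec_tendstoI) (auto intro!: tendsto_intros assms)
  then show ?thesis
    unfolding iter_weight_def right_deriv_entries_def group_norms_def
    by (intro vec_tendstoI) (auto intro!: psi.tendsto_right_deriv tendsto_norm)
qed

lemma Phi_subseq_limit:
  assumes "filterlim r sequentially sequentially" "(\<lambda>n. x (r n)) \<longlonglongrightarrow> xs"
  shows "Phi xs = \<sigma>"
  using LIMSEQ_unique[OF tendsto_Phi[OF assms(2)] filterlim_compose[OF Phi_lim assms(1)]] .

text \<open>Up to a null sequence \<open>u\<close> may be replaced by \<open>p\<close>, and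
  \<open>v k * p k\<close> is the continuous function \<open>e\<close> of
  \<open>x k\<close>.\<close>

lemma v_u_subseq_limit:
  assumes "filterlim r sequentially sequentially" "(\<lambda>n. x (r n)) \<longlonglongrightarrow> xs"
  shows "(\<lambda>n. transpose A *v (v (r n) * u (r n))) \<longlonglongrightarrow> transpose A *v e xs"
proof -
  have "(\<lambda>n. v (r n) * (p (r n) - u (r n))) \<longlonglongrightarrow> 0"
    using filterlim_compose[OF scaled_v_lim[OF p_minus_u_lim] assms(1)] .
  then have "(\<lambda>n. e (x (r n)) - v (r n) * (p (r n) - u (r n))) \<longlonglongrightarrow> e xs - 0"
    by (intro tendsto_diff tendsto_e assms(2))
  then have "(\<lambda>n. v (r n) * u (r n)) \<longlonglongrightarrow> e xs"
    by (simp add: v_p_eq[symmetric] algebra_simps)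
  then show ?thesis by (rule bounded_linear.tendsto[OF matrix_vector_mul_bounded_linear])
qed

text \<open>An entry of \<open>e z\<close> vanishes only at a zero residual or where \<open>\<phi>\<close> has reached its supremum,
  so \<open>\<Phi>\<close> takes one of the excluded values of \<open>\<sigma>\<close> at a zero of \<open>e\<close>.\<close>

lemma e_nonzero:
  assumes "Phi z = \<sigma>"
  shows "e z \<noteq> 0"
proof
  assume e0: "e z = 0"
  define d where "d = A *v z - b"
  define J where "J = {i. d $ i \<noteq> 0}"
  have max: "phi_bar \<phi> = ereal (\<phi> ((d $ i)\<^sup>2))" if "i \<in> J" for i
  proof -
    have "right_deriv \<phi> ((d $ i)\<^sup>2) * d $ i = e z $ i" by (simp add: e_def d_def)
    then have "right_deriv \<phi> ((d $ i)\<^sup>2) = 0" using that e0 by (simp add: J_def)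
    then have "\<phi> t \<le> \<phi> ((d $ i)\<^sup>2)" if "0 \<le> t" for t
      using phi.tangent[of "(d $ i)\<^sup>2" t] that by simp
    then show ?thesis
      unfolding phi_bar_def by (intro antisym SUP_least SUP_upper2[of "(d $ i)\<^sup>2"]) auto
  qed
  have "Phi z = (\<Sum>i\<in>J. \<phi> ((d $ i)\<^sup>2))"
    unfolding Phi_eq d_def[symmetric]
    by (rule sum.mono_neutral_right) (auto simp: J_def phi_0)
  then have sigma: "\<sigma> = (\<Sum>i\<in>J. \<phi> ((d $ i)\<^sup>2))" using assms by simp
  \<comment> \<open>Positivity of \<open>\<sigma>\<close> rules out the multiple \<open>0\<close>,
    so the cardinality of \<open>J\<close> lies in the excluded range.\<close>
  then have "J \<noteq> {}" using sigma_pos by auto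
  then obtain j where j: "j \<in> J" by blast
  have "\<phi> ((d $ i)\<^sup>2) = \<phi> ((d $ j)\<^sup>2)" if "i \<in> J" for i
    using max[OF that] max[OF j] by simp
  then have "ereal \<sigma> = ereal (real (card J)) * phi_bar \<phi>"
    using sigma max[OF j] by simp
  moreover have "card J \<in> {1..CARD('m)}"
    using \<open>J \<noteq> {}\<close> by (auto simp: Suc_le_eq card_gt_0_iff intro: card_mono)
  ultimately show False using sigma_phi_bar by blast
qed

section \<open>Upper bound for the multipliers\<close>

text \<open>Test the subgradient inequality in the direction \<open>g k\<close> itself and use the
  Lipschitz constant of the weighted norm.\<close>

lemma g_bounded: "norm (g k) \<le> real CARD('q) * right_deriv \<psi> 0"
proof -
  let ?C = "real CARD('q) * right_deriv \<psi> 0"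
  have "weighted_norm G (w k) (xt (Suc k)) + g k \<bullet> g k \<le> weighted_norm G (w k) (xt (Suc k) + g k)"
    using g_subgradient[of k] unfolding subdifferential_def
    by (auto dest: spec[of _ "xt (Suc k) + g k"])
  moreover have "\<bar>weighted_norm G (w k) (xt (Suc k) + g k) - weighted_norm G (w k) (xt (Suc k))\<bar>
      \<le> ?C * norm (xt (Suc k) + g k - xt (Suc k))"
    by (intro weighted_norm_lipschitz w_nonneg w_le)
  ultimately have "norm (g k) * norm (g k) \<le> ?C * norm (g k)"
    by (simp add: power2_norm_eq_inner[symmetric] power2_eq_square)
  then show ?thesis
    using psi_deriv_pos[of 0] by (cases "g k = 0") auto
qed

text \<open>Since \<open>\<xi>\<close> and \<open>g\<close> are bounded, division by diverging
  multipliers sends \<open>transpose A *v (v k * u k)\<close> to \<open>0\<close> along a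
  subsequence. Its limit is also \<open>transpose A *v e xs\<close>, so full row rank gives
  \<open>e xs = 0\<close>, against \<open>e_nonzero\<close>.\<close>

lemma l_bounded: "bounded (range l)"
proof (rule ccontr)
  assume unbounded: "\<not> bounded (range l)"
  have "\<exists>k\<ge>n. real n < l k" for n
  proof (rule ccontr)
    assume "\<not> ?thesis"
    then have "bounded (l ` {n..})"
      using l_nonneg by (auto simp: bounded_iff intro!: exI[of _ "real n"])
    moreover have "bounded (l ` {..<n})" by (simp add: finite_imp_bounded)
    moreover have "range l = l ` {..<n} \<union> l ` {n..}"
      by (auto simp: image_Un[symmetric] ivl_disj_un)
    ultimately show False using unbounded by simp
  qed
  then obtain r0 where r0: "\<And>n. n \<le> r0 n" "\<And>n. real n < l (r0 n)" by metis
  obtain R where "\<And>k. norm (x k) \<le> R" by (rule x_bounded) blast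
  then have "bounded (range (\<lambda>n. x (r0 n)))" by (auto simp: bounded_iff)
  then obtain xs h where h: "strict_mono h" "((\<lambda>n. x (r0 n)) \<circ> h) \<longlonglongrightarrow> xs"
    using bounded_imp_convergent_subsequence by blast
  define r where "r n = r0 (h n)" for n
  \<comment> \<open>The selection \<open>r0\<close> need not be monotone; the bound
    \<open>n \<le> r n\<close> is enough for \<open>r\<close> to tend to infinity.\<close>
  have n_le: "n \<le> r n" for n
    using r0(1)[of "h n"] strict_mono_imp_increasing[OF h(1), of n] by (simp add: r_def)
  have n_less: "real n < l (r n)" for n
    using r0(2)[of "h n"] strict_mono_imp_increasing[OF h(1), of n] by (simp add: r_def)
  have r: "filterlim r sequentially sequentially"
    by (rule filterlim_at_top_mono[OF filterlim_ident]) (simp add: n_le)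
  have xr: "(\<lambda>n. x (r n)) \<longlonglongrightarrow> xs" using h(2) by (simp add: r_def o_def)
  obtain B1 where B1: "\<And>k. norm (\<xi> k) \<le> B1"
    using convergent_imp_Bseq[OF convergentI[OF xi_lim]] by (auto simp: Bseq_def)
  define B where "B = B1 + real CARD('q) * right_deriv \<psi> 0"
  have "(\<lambda>n. transpose A *v (v (r n) * u (r n))) \<longlonglongrightarrow> 0"
  proof (rule Lim_null_comparison)
    have "norm (transpose A *v (v (r n) * u (r n))) \<le> B * (1 / real n)" if "0 < n" for n
    proof -
      let ?z = "transpose A *v (v (r n) * u (r n))"
      have "l (r n) *\<^sub>R ?z = \<xi> (r n) - g (r n)" by (simp add: g_def)
      then have "norm (l (r n) *\<^sub>R ?z) \<le> B"
        using norm_triangle_ineq4[of "\<xi> (r n)" "g (r n)"] B1[of "r n"] g_bounded[of "r n"]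
        by (simp add: B_def)
      then have "l (r n) * norm ?z \<le> B" using l_nonneg by simp
      moreover have "real n * norm ?z \<le> l (r n) * norm ?z"
        using n_less[of n] by (intro mult_right_mono) auto
      ultimately show ?thesis using that by (simp add: field_simps)
    qed
    then show "\<forall>\<^sub>F n in sequentially. norm (transpose A *v (v (r n) * u (r n))) \<le> B * (1 / real n)"
      by (rule eventually_mono[OF eventually_gt_at_top[of 0]])
    show "(\<lambda>n. B * (1 / real n)) \<longlonglongrightarrow> 0"
      using tendsto_mult_right_zero[OF lim_1_over_n] .
  qed
  then have "transpose A *v e xs = transpose A *v 0"
    using LIMSEQ_unique[OF v_u_subseq_limit[OF r xr]] by simp
  then have "e xs = 0" by (rule injD[OF full_rank_transpose_inj[OF full_rank]])
  then show False using e_nonzero[OF Phi_subseq_limit[OF r xr]] by simp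
qed

text \<open>With bounded multipliers, \<open>g_inner\<close> reduces this to
  \<open>xi_step_lim\<close> and \<open>p_minus_q_lim\<close>.\<close>

lemma g_step_lim: "(\<lambda>k. g k \<bullet> (x k - xt (Suc k))) \<longlonglongrightarrow> 0"
proof -
  obtain C where C: "\<And>k. \<bar>l k\<bar> \<le> C" using l_bounded by (auto simp: bounded_iff)
  have "(\<lambda>k. l k * (u k \<bullet> (p k - q k))) \<longlonglongrightarrow> 0"
  proof (rule Lim_null_comparison)
    have "norm (l k * (u k \<bullet> (p k - q k))) \<le> C * sqrt \<sigma> * norm (p k - q k)" for k
    proof -
      have "\<bar>l k\<bar> * \<bar>u k \<bullet> (p k - q k)\<bar> \<le> C * (sqrt \<sigma> * norm (p k - q k))"
        using C[of k] norm_u_le_sigma[of k]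
        by (intro mult_mono order_trans[OF Cauchy_Schwarz_ineq2] mult_right_mono) auto
      then show ?thesis by (simp add: abs_mult mult.assoc)
    qed
    then show "\<forall>\<^sub>F k in sequentially. norm (l k * (u k \<bullet> (p k - q k))) \<le> C * sqrt \<sigma> * norm (p k - q k)"
      by simp
    show "(\<lambda>k. C * sqrt \<sigma> * norm (p k - q k)) \<longlonglongrightarrow> 0"
      by (rule tendsto_mult_right_zero[OF tendsto_norm_zero[OF p_minus_q_lim]])
  qed
  from tendsto_diff[OF tendsto_minus[OF xi_step_lim] this] show ?thesis by (simp add: g_inner)
qed

text \<open>The approximate solutions \<open>xt\<close> need not approach the accumulation point. However, both the
  weighted norms and the linear terms \<open>g\<^sup>k\<close> agree asymptotically at \<open>x\<^sup>k\<close> and \<open>xt\<^sup>k\<^sup>+\<^sup>1\<close>, so the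
  subgradient inequality may be transferred to \<open>x\<^sup>k\<close>.\<close>

lemma accumulation_point_stationary:
  assumes "accumulation_point x xs"
  shows "stationary_point A b \<sigma> \<psi> \<phi> G xs"
proof -
  obtain r0 where r0: "strict_mono r0" "(x \<circ> r0) \<longlonglongrightarrow> xs"
    using assms by (auto simp: accumulation_point_def)
  have "bounded (range (\<lambda>n. l (r0 n)))" by (rule bounded_subset[OF l_bounded]) auto
  then obtain \<Lambda> h where h: "strict_mono h" "((\<lambda>n. l (r0 n)) \<circ> h) \<longlonglongrightarrow> \<Lambda>"
    using bounded_imp_convergent_subsequence by blast
  define r where "r = r0 \<circ> h"
  have r: "filterlim r sequentially sequentially"
    unfolding r_def by (intro filterlim_subseq strict_mono_o r0 h)
  have xr: "(\<lambda>n. x (r n)) \<longlonglongrightarrow> xs"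
    using LIMSEQ_subseq_LIMSEQ[OF r0(2) h(1)] by (simp add: r_def o_def)
  have lr: "(\<lambda>n. l (r n)) \<longlonglongrightarrow> \<Lambda>" using h(2) by (simp add: r_def o_def)
  have \<Lambda>: "0 \<le> \<Lambda>" by (rule LIMSEQ_le_const[OF lr]) (use l_nonneg in auto)
  define gs where "gs = - (\<Lambda> *\<^sub>R (transpose A *v e xs))"
  have "(\<lambda>n. \<xi> (r n) - l (r n) *\<^sub>R (transpose A *v (v (r n) * u (r n))))
      \<longlonglongrightarrow> 0 - \<Lambda> *\<^sub>R (transpose A *v e xs)"
    by (intro tendsto_diff tendsto_scaleR lr v_u_subseq_limit r xr filterlim_compose[OF xi_lim])
  then have gr: "(\<lambda>n. g (r n)) \<longlonglongrightarrow> gs" by (simp add: g_def gs_def)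
  let ?W = "weighted_norm G (iter_weight \<psi> G xs)"
  have wr: "(\<lambda>n. w (r n)) \<longlonglongrightarrow> iter_weight \<psi> G xs"
    unfolding w_def by (rule tendsto_iter_weight[OF xr])
  have "?W xs + gs \<bullet> (z - xs) \<le> ?W z" for z
  proof -
    let ?gap = "\<lambda>k. weighted_norm G (w k) (x k) - weighted_norm G (w k) (xt (Suc k))"
    have "weighted_norm G (w k) (x k) - ?gap k + g k \<bullet> (x k - xt (Suc k)) + g k \<bullet> (z - x k)
        \<le> weighted_norm G (w k) z" for k
    proof -
      have "weighted_norm G (w k) (xt (Suc k)) + g k \<bullet> (z - xt (Suc k)) \<le> weighted_norm G (w k) z"
        using g_subgradient[of k] by (simp add: subdifferential_def)
      then show ?thesis by (simp add: inner_diff_right)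
    qed
    moreover have "(\<lambda>n. weighted_norm G (w (r n)) (x (r n)) - ?gap (r n)
        + g (r n) \<bullet> (x (r n) - xt (Suc (r n))) + g (r n) \<bullet> (z - x (r n)))
        \<longlonglongrightarrow> ?W xs - 0 + 0 + gs \<bullet> (z - xs)"
      by (intro tendsto_add tendsto_diff tendsto_inner tendsto_const gr xr
          tendsto_weighted_norm wr filterlim_compose[OF weighted_gap_lim r]
          filterlim_compose[OF g_step_lim r])
    moreover have "(\<lambda>n. weighted_norm G (w (r n)) z) \<longlonglongrightarrow> ?W z"
      by (intro tendsto_weighted_norm wr tendsto_const)
    ultimately show ?thesis using LIMSEQ_le by fastforce
  qed
  then have sub: "gs \<in> subdifferential ?W xs" by (simp add: subdifferential_def)
  have row: "row i A \<bullet> z = (A *v z) $ i" for i z by (simp add: matrix_mult_dot row_def)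
  \<comment> \<open>The stationarity condition carries a factor \<open>2\<close> that the
    multipliers \<open>l\<close> already include, so the witness is half of their limit.\<close>
  have "(2 * (\<Lambda> / 2)) *\<^sub>R (\<Sum>i\<in>UNIV. (right_deriv \<phi> ((row i A \<bullet> xs - b $ i)\<^sup>2)
      * (row i A \<bullet> xs - b $ i)) *\<^sub>R row i A) = - gs"
    unfolding gs_def transpose_mult_times by (simp add: e_def row)
  then show ?thesis
    unfolding stationary_point_def Phi_def[symmetric] Phi_subseq_limit[OF r xr]
    using \<Lambda> sub
    by (intro exI[of _ "\<Lambda> / 2"]) (auto simp: iter_weight_def intro!: exI[of _ gs])
qed

end

theorem theorem2:
  fixes A :: "real ^ 'n ^ 'm" and b :: "real ^ 'm" and \<sigma> :: real
    and \<psi> \<phi> :: "real \<Rightarrow> real"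
    and G :: "'q::finite \<Rightarrow> 'n set"
    and f :: "real ^ 'n \<Rightarrow> real"
    and \<tau> \<mu> \<epsilon> l :: "nat \<Rightarrow> real"
    and x xt \<xi> :: "nat \<Rightarrow> real ^ 'n"
    and ut :: "nat \<Rightarrow> real ^ 'm"
  assumes "standing_assumptions A b \<sigma> \<psi> \<phi>"
    and "group_partition G"
    and "continuously_differentiable f"
    and "strictly_convex_on UNIV f"
    and "generated_by_algorithm A b \<sigma> \<psi> \<phi> G f \<tau> \<mu> \<epsilon> x xt ut"
    and "\<And>k. associated_multiplier A b \<sigma> \<psi> \<phi> G f (\<epsilon> k)
               (x k) (xt (Suc k)) (ut (Suc k)) (\<xi> k) (l k)"
  shows "liminf (\<lambda>k. ereal (l k)) > 0 \<and>
    (\<forall>i. (\<lambda>k. right_deriv \<phi> ((row i A \<bullet> x k - b $ i)\<^sup>2) * (row i A \<bullet> (xt (Suc k) - x k)))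
            \<longlonglongrightarrow> 0) \<and>
    (\<forall>xs. accumulation_point x xs \<longrightarrow>
            sum_entries \<phi> ((A *v xs - b) * (A *v xs - b)) = \<sigma>) \<and>
    bounded (range l) \<and>
    (\<forall>xs. accumulation_point x xs \<longrightarrow> stationary_point A b \<sigma> \<psi> \<phi> G xs)"
proof -
  interpret algorithm_run A b \<sigma> \<psi> \<phi> G f \<tau> \<mu> \<epsilon> l x xt \<xi> ut
    by (rule algorithm_run.intro) fact+
  obtain c where c: "0 < c" "\<forall>\<^sub>F k in sequentially. c \<le> l k" by (rule l_bounded_below)
  have "ereal c \<le> liminf (\<lambda>k. ereal (l k))"
    using c(2) by (intro Liminf_bounded) simp
  then have "liminf (\<lambda>k. ereal (l k)) > 0"
    using c(1) by (metis ereal_less(2) less_le_trans)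
  moreover have "sum_entries \<phi> ((A *v xs - b) * (A *v xs - b)) = \<sigma>" if "accumulation_point x xs" for xs
    using that Phi_subseq_limit filterlim_subseq
    by (auto simp: accumulation_point_def o_def Phi_def)
  ultimately show ?thesis
    using scaled_step_lim l_bounded accumulation_point_stationary by blast
qed

end
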